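(* Let $X_n$ be an iid random matrix whose atom distribution has finite fourth moment, and let $\mu\in\mathbb{C}$ be a non-zero quantity independent of $n$. Let $\phi_n:=\frac{1}{\sqrt n}(1,\dots,1)^*\in\mathbb{C}^n$. Then almost surely, for sufficiently large $n$, all the eigenvalues of $\frac{1}{\sqrt n}X_n+\mu\sqrt n\,\phi_n\phi_n^*$ lie in the disk $\{z\in\mathbb{C}:|z|\le 1+o(1)\}$, with a single exception taking the value $\mu\sqrt n+o(1)$.
   Context: An iid random matrix is a nested sequence of $n\times n$ random matrices $X_n=(x_{ij})_{1\le i,j\le n}$ whose entries $x_{ij}$, $i,j\ge1$, are independent identically distributed complex random variables with a common distribution $x$ (the atom distribution) normalised so that $\mathbb{E}x=0$ and $\mathbb{E}|x|^2=1$. $o(1)$ denotes a quantity bounded in magnitude by some $c(n)\to0$ as $n\to\infty$ (with $\mu$ fixed). Eigenvalues are counted with multiplicity. *)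

theory Defs
  imports "HOL-Probability.Probability" "Jordan_Normal_Form.Char_Poly"
begin

text \<open>The perturbed matrix (1/sqrt n) X_n + mu sqrt n phi_n phi_n^*, whose (i,j) entry
  (0-based, i,j < n) is (x_ij + mu)/sqrt n.\<close>
definition perturbed_matrix :: "(nat \<Rightarrow> nat \<Rightarrow> complex) \<Rightarrow> complex \<Rightarrow> nat \<Rightarrow> complex mat" where
  "perturbed_matrix X \<mu> n =
     mat n n (\<lambda>(i,j). X i j / complex_of_real (sqrt (real n))
                       + \<mu> * complex_of_real (sqrt (real n)) * (1 / complex_of_real (real n)))"

definition eig_mult :: "complex mat \<Rightarrow> complex \<Rightarrow> nat" where
  "eig_mult A z = order z (char_poly A)"

end

theory Submission
  imports "HOL-Complex_Analysis.Complex_Analysis" "HOL-Real_Asymp.Real_Asymp" Defs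
begin

text \<open>
  By the fourth moment, almost surely all entries of the \<open>n \<times> n\<close> matrix are eventually at most
  \<open>\<kappa> * sqrt n\<close>, for any fixed \<open>\<kappa>\<close>, so one may truncate and centre; let \<open>A\<close> be the resulting matrix divided
  by \<open>sqrt n\<close>. The fourth moment of a sum of products of entries of \<open>A\<close> along walks of length \<open>k\<close> is a sum over
  quadruples of walks in which every edge is used at least twice. Counting these gives
  \<open>O(n powr (19/8))\<close> for all \<open>k \<le> C * ln n\<close>. By Borel-Cantelli, almost surely for large \<open>n\<close> and all such \<open>k\<close>, the
  entries of \<open>A ^ k\<close> are at most \<open>n\<^sup>2\<close> and \<open>\<phi>\<^sup>* A ^ k \<phi> = o(1)\<close>.

  For \<open>r > 1\<close> and \<open>C\<close> large, \<open>r ^ k\<close> beats every polynomial loss at \<open>k = C * ln n\<close>. Hence \<open>A\<close> has no eigenvalue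
  with \<open>|z| \<ge> r\<close>, and \<open>\<phi>\<^sup>* z (z - A)\<^sup>-\<^sup>1 \<phi> = 1 + o(1) / z\<close> uniformly there. With the determinant formula for
  rank-one perturbations and \<open>c = \<mu> * sqrt n + o(1)\<close>, the eigenvalues of the perturbed matrix in
  \<open>|z| \<ge> r\<close> are the solutions of \<open>z = c (1 + o(1) / z)\<close>; by Rouche's theorem there is exactly one.
\<close>

section \<open>Counting quadruples of walks\<close>

text \<open>The operator norm of \<open>A\<close> is typically near 2, so for |z| > 1 the resolvent
  is controlled through powers of logarithmic length, not through a norm bound. Fourth moments are
  taken because Borel-Cantelli needs summable probabilities: the sum over all walks of length k has
  second moment of order n, which at scale n gives only 1 / n. In a quadruple of walks at most two
  vertices are never left, so there are at most two more vertices than edges; this yields n^2 up to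
  a loss of n^(3/8), and after division by n^4 a summable bound.

  The obstacle is that the truncated entries of \<open>A\<close> are only bounded by a constant
  \<eta>, while k grows like ln n. Third and later uses of an edge each pay a factor \<eta>, but
  have as many choices as there are used edges leaving the vertex. A quadruple with many such
  choices has correspondingly fewer vertices than edges. The trade works if \<eta> * k is a small
  multiple of ln n, so \<eta> is fixed after the constant \<open>C\<close>, and \<open>C\<close>
  after r.\<close>

definition occ :: "nat set \<Rightarrow> (nat \<Rightarrow> 'a) \<Rightarrow> nat \<Rightarrow> nat" where
  "occ S f t = card {s\<in>S. s < t \<and> f s = f t}"

text \<open>Ranks in a finite set are distinct and smaller than its size, so by cardinality every
  rank is attained.\<close>

lemma ex_card_below:
  fixes F :: "nat set"
  assumes "finite F" "j < card F"
  shows "\<exists>t\<in>F. card {s\<in>F. s < t} = j"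
proof -
  let ?g = "\<lambda>t. card {s\<in>F. s < t}"
  have less: "?g t < ?g t'" if "t \<in> F" "t < t'" for t t'
    using assms that by (intro psubset_card_mono) auto
  have "inj_on ?g F"
    by (rule linorder_inj_onI') (use less in force)
  moreover have "?g ` F \<subseteq> {..<card F}"
    using assms by (auto intro!: psubset_card_mono)
  ultimately have "?g ` F = {..<card F}"
    by (intro card_subset_eq) (auto simp: card_image)
  then show ?thesis using assms(2) by (metis (no_types, lifting) imageE lessThan_iff)
qed

text \<open>Inside a fibre of \<open>f\<close> the number \<open>occ\<close> is the rank, so a fibre
  with more than \<open>j\<close> elements has exactly one position of number \<open>j\<close>. The
  value 0 marks the first use of an edge, the value 1 the second.\<close>

lemma bij_betw_occ:
  assumes "finite S" and "\<And>e. e \<in> f ` S \<Longrightarrow> j < card {s\<in>S. f s = e}"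
  shows "bij_betw f {t\<in>S. occ S f t = j} (f ` S)"
proof (rule bij_betw_imageI)
  have less: "occ S f t < occ S f t'" if "t \<in> S" "t < t'" "f t = f t'" for t t'
    using assms that unfolding occ_def by (intro psubset_card_mono) auto
  show "inj_on f {t\<in>S. occ S f t = j}"
    by (rule linorder_inj_onI') (use less in force)
  show "f ` {t\<in>S. occ S f t = j} = f ` S"
  proof (intro equalityI subsetI)
    fix e assume e: "e \<in> f ` S"
    obtain t where t: "t \<in> {s\<in>S. f s = e}" "card {s\<in>{s\<in>S. f s = e}. s < t} = j"
      using ex_card_below[of "{s\<in>S. f s = e}" j] assms e by auto
    have "{s\<in>{s\<in>S. f s = e}. s < t} = {s\<in>S. s < t \<and> f s = f t}" using t by auto
    then show "e \<in> f ` {t\<in>S. occ S f t = j}" using t by (auto simp: occ_def)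
  qed auto
qed

lemma occ_eq_0_iff: "finite S \<Longrightarrow> occ S f t = 0 \<longleftrightarrow> f t \<notin> f ` {s\<in>S. s < t}"
  unfolding occ_def by (auto simp: image_iff)

lemma card_first_occurrences:
  fixes S :: "nat set"
  assumes "finite S"
  shows "card {t\<in>S. f t \<notin> f ` {s\<in>S. s < t}} = card (f ` S)"
proof -
  have "bij_betw f {t\<in>S. occ S f t = 0} (f ` S)"
    using assms by (intro bij_betw_occ) (auto simp: card_gt_0_iff)
  then show ?thesis using assms by (simp add: occ_eq_0_iff bij_betw_same_card)
qed

text \<open>The factor at \<open>t\<close> sees only positions up to \<open>t\<close>, so the last
  position can be summed out with the past held fixed, as for conditional probabilities. Each
  summation costs one factor \<open>C\<close>.\<close>

lemma sum_prod_prefix_le: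
  fixes f :: "(nat \<Rightarrow> nat) \<Rightarrow> nat \<Rightarrow> real"
  assumes nonneg: "\<And>w t. f w t \<ge> 0"
    and prefix: "\<And>w w' t. (\<And>s. s \<le> t \<Longrightarrow> w s = w' s) \<Longrightarrow> f w t = f w' t"
    and bound: "\<And>w t. t < T \<Longrightarrow> (\<Sum>y<n. f (w(t := y)) t) \<le> C"
  shows "(\<Sum>w\<in>PiE {..<T} (\<lambda>_. {..<n}). \<Prod>t<T. f w t) \<le> C ^ T"
  using bound
proof (induction T)
  case 0
  then show ?case by simp
next
  case (Suc T)
  let ?E = "PiE {..<T} (\<lambda>_. {..<n})"
  have C: "0 \<le> C" using Suc.prems[of 0 undefined] by (meson nonneg order_trans sum_nonneg zero_less_Suc)
  have eq: "(\<Prod>t<T. f (w(T := y)) t) = (\<Prod>t<T. f w t)" for w y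
    by (intro prod.cong prefix) auto
  have "(\<Sum>w\<in>PiE {..<Suc T} (\<lambda>_. {..<n}). \<Prod>t<Suc T. f w t)
      = (\<Sum>w\<in>(\<lambda>(y, g). g(T := y)) ` ({..<n} \<times> ?E). \<Prod>t<Suc T. f w t)"
    by (simp add: lessThan_Suc PiE_insert_eq)
  also have "\<dots> = (\<Sum>(y, w)\<in>{..<n} \<times> ?E. \<Prod>t<Suc T. f (w(T := y)) t)"
    by (subst sum.reindex) (auto intro!: inj_combinator simp: case_prod_beta)
  also have "\<dots> = (\<Sum>w\<in>?E. \<Sum>y<n. (\<Prod>t<T. f w t) * f (w(T := y)) T)"
    by (subst sum.cartesian_product[symmetric], subst sum.swap) (simp add: eq)
  also have "\<dots> = (\<Sum>w\<in>?E. (\<Prod>t<T. f w t) * (\<Sum>y<n. f (w(T := y)) T))"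
    by (simp add: sum_distrib_left)
  also have "\<dots> \<le> (\<Sum>w\<in>?E. (\<Prod>t<T. f w t) * C)"
    by (intro sum_mono mult_left_mono prod_nonneg Suc.prems) (auto simp: nonneg)
  also have "\<dots> \<le> C ^ T * C"
    unfolding sum_distrib_right[symmetric]
    by (intro mult_right_mono Suc.IH Suc.prems C) auto
  finally show ?case by (simp add: mult.commute)
qed

text \<open>
  Four consecutive walks with \<open>k\<close> steps each are stored as one sequence of length \<open>4 * Suc k\<close>;
  the positions divisible by \<open>Suc k\<close> are the starting points, so \<open>t - 1\<close> never truncates on \<open>steps k\<close>.
\<close>

definition steps :: "nat \<Rightarrow> nat set" where
  "steps k = {t. t < 4 * Suc k \<and> t mod Suc k \<noteq> 0}"

definition edge :: "(nat \<Rightarrow> nat) \<Rightarrow> nat \<Rightarrow> nat \<times> nat" where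
  "edge w t = (w (t - 1), w t)"

definition edges_covered_twice :: "nat \<Rightarrow> (nat \<Rightarrow> nat) \<Rightarrow> bool" where
  "edges_covered_twice k w \<longleftrightarrow> (\<forall>e\<in>edge w ` steps k. 2 \<le> card {t\<in>steps k. edge w t = e})"

text \<open>A bound for the expected product of entries along four walks. Each distinct edge
  contributes one variance, at most \<open>1 / n\<close>; each use beyond the second contributes the
  sup bound \<eta>. An edge used only once makes the expectation vanish, by independence and
  centring.\<close>

definition walk_weight :: "nat \<Rightarrow> nat \<Rightarrow> real \<Rightarrow> (nat \<Rightarrow> nat) \<Rightarrow> real" where
  "walk_weight n k \<eta> w = (if edges_covered_twice k w
     then (1 / real n) ^ card (edge w ` steps k) * \<eta> ^ (4 * k - 2 * card (edge w ` steps k)) else 0)"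

text \<open>The number of possible continuations at \<open>t\<close> if the step is to repeat a used
  edge.\<close>

definition out_degree :: "nat \<Rightarrow> (nat \<Rightarrow> nat) \<Rightarrow> nat \<Rightarrow> nat" where
  "out_degree k w t = card {e\<in>edge w ` {s\<in>steps k. s < t}. fst e = w (t - 1)}"

text \<open>
  The weight of a quadruple is distributed over its positions such that, given the past,
  the weights of all possible next vertices add up to almost \<open>1\<close>. With \<open>q ^ 16 = 1 / n\<close>, a fresh vertex is
  charged the full \<open>1 / n\<close>, while each revisited vertex and each additional edge leaving a vertex pays
  a small power of \<open>q\<close>. Choosing among several used edges costs \<open>q\<close> at the first repetition and
  \<open>\<eta> * exp (- 2 * \<eta> * d)\<close> later; the exponential makes the sum over the \<open>d\<close> choices bounded
  uniformly in \<open>d\<close>.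
\<close>

definition step_weight :: "nat \<Rightarrow> real \<Rightarrow> real \<Rightarrow> (nat \<Rightarrow> nat) \<Rightarrow> nat \<Rightarrow> real" where
  "step_weight k q \<eta> w t =
     (if t \<notin> steps k then (if w t \<notin> w ` {..<t} then q ^ 16 else q\<^sup>2)
      else if edge w t \<notin> edge w ` {s\<in>steps k. s < t}
      then (if w t \<notin> w ` {..<t} then q ^ 16 else q\<^sup>2) * (if out_degree k w t = 0 then 1 else q\<^sup>2)
      else if occ (steps k) (edge w) t = 1 then (if out_degree k w t \<le> 1 then 1 else q)
      else \<eta> * exp (- 2 * \<eta> * real (out_degree k w t)))"

section \<open>Positions in four walks and the sum over the next vertex\<close>

lemma finite_steps [simp]: "finite (steps k)"
  unfolding steps_def by (rule finite_subset[of _ "{..<4 * Suc k}"]) auto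

lemma steps_pos: "t \<in> steps k \<Longrightarrow> 0 < t"
  unfolding steps_def by (cases t) auto

lemma steps_less: "t \<in> steps k \<Longrightarrow> t < 4 * Suc k"
  unfolding steps_def by auto

text \<open>Coordinates (walk, step within the walk), in which a product over \<open>steps k\<close>
  splits into four products over single walks.\<close>

lemma steps_image: "steps k = (\<lambda>(b, i). b * Suc k + Suc i) ` ({..<4} \<times> {..<k})"
proof (intro equalityI subsetI)
  fix t assume t: "t \<in> steps k"
  then have "t div Suc k < 4" "0 < t mod Suc k"
    by (auto simp: steps_def less_mult_imp_div_less)
  moreover have "t mod Suc k - 1 < k"
    using \<open>0 < t mod Suc k\<close> mod_less_divisor[of "Suc k" t] by linarith
  moreover have "t = t div Suc k * Suc k + Suc (t mod Suc k - 1)"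
    using \<open>0 < t mod Suc k\<close> by (simp del: mult_Suc_right)
  ultimately show "t \<in> (\<lambda>(b, i). b * Suc k + Suc i) ` ({..<4} \<times> {..<k})"
    by (intro image_eqI[where x = "(t div Suc k, t mod Suc k - 1)"]) auto
next
  fix t assume "t \<in> (\<lambda>(b, i). b * Suc k + Suc i) ` ({..<4} \<times> {..<k})"
  then obtain b i where bi: "b < 4" "i < k" "t = b * Suc k + Suc i" by auto
  have "b * Suc k \<le> 3 * Suc k" using bi by (intro mult_right_mono) auto
  moreover have "(b * Suc k + Suc i) mod Suc k = Suc i" using bi by (subst mod_mult_self3) auto
  ultimately show "t \<in> steps k" using bi unfolding steps_def by auto
qed

lemma inj_steps: "inj_on (\<lambda>(b, i). b * Suc k + Suc i) ({..<4} \<times> {..<k})"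
proof (rule inj_onI, clarsimp)
  fix b i b' i' assume *: "i < k" "i' < k" "b + b * k + i = b' + b' * k + i'"
  have "(b * Suc k + Suc i) div Suc k = b" "(b' * Suc k + Suc i') div Suc k = b'"
    using * by (auto simp: div_add1_eq[of _ "Suc _"] simp del: mult_Suc_right add_Suc_right)
  moreover have "b * Suc k + Suc i = b' * Suc k + Suc i'" using * by simp
  ultimately have "b = b'" by metis
  then show "b = b' \<and> i = i'" using * by simp
qed

lemma card_steps: "card (steps k) = 4 * k"
  unfolding steps_image using inj_steps by (subst card_image) auto

lemma step_weight_nonneg: "0 \<le> q \<Longrightarrow> 0 \<le> \<eta> \<Longrightarrow> 0 \<le> step_weight k q \<eta> w t"
  unfolding step_weight_def by auto

lemma step_weight_prefix:
  assumes "\<And>s. s \<le> t \<Longrightarrow> w s = w' s"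
  shows "step_weight k q \<eta> w t = step_weight k q \<eta> w' t"
proof -
  have e: "edge w s = edge w' s" if "s \<le> t" for s
    using that assms by (auto simp: edge_def)
  have im: "edge w ` {s\<in>steps k. s < t} = edge w' ` {s\<in>steps k. s < t}"
    by (intro image_cong) (auto simp: e)
  have "occ (steps k) (edge w) t = occ (steps k) (edge w') t"
    unfolding occ_def by (rule arg_cong[where f = card]) (auto simp: e)
  moreover have "out_degree k w t = out_degree k w' t"
    unfolding out_degree_def im using assms[of "t - 1"] by simp
  moreover have "w ` {..<t} = w' ` {..<t}"
    by (intro image_cong) (auto simp: assms)
  ultimately show ?thesis
    unfolding step_weight_def im using assms e[of t] by simp
qed

text \<open>At each position only one kind of continuation has total weight about 1. At a starting
  point, or if no used edge leaves the current vertex, these are the at most \<open>n\<close> fresh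
  vertices at \<open>1 / n\<close> each. If one used edge leaves it, repeating that edge has weight
  at most 1 and every new edge pays \<open>q\<^sup>2\<close>. If \<open>d \<ge> 2\<close> used edges
  leave it, second uses cost \<open>q\<close> each and later uses sum to
  \<open>d * \<eta> * exp (- 2 * \<eta> * d) \<le> 1\<close>. Everything else is of order
  \<open>k * q\<close>.\<close>

lemma sum_step_weight_le:
  assumes q: "0 < q" "q \<le> 1" "q ^ 16 = 1 / real n" and n: "0 < n" and \<eta>: "0 < \<eta>" "\<eta> \<le> 1"
    and t: "t < 4 * Suc k"
  shows "(\<Sum>y<n. step_weight k q \<eta> (w(t := y)) t) \<le> 1 + 3 * real (4 * Suc k) * q"
proof -
  let ?T = "real (4 * Suc k)"
  define d where "d = out_degree k w t"
  define Y where "Y = {y. (w (t - 1), y) \<in> edge w ` {s\<in>steps k. s < t}}"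
  \<comment> \<open>A common bound for the weight of any repeated edge; whether it is a second or a
    later use depends on the chosen vertex, hence the sum of both weights.\<close>
  define \<rho> where "\<rho> = (if d \<le> 1 then 1 else q + \<eta> * exp (- 2 * \<eta> * real d))"
  have \<rho>0: "0 \<le> \<rho>" using q \<eta> by (auto simp: \<rho>_def)
  have upd: "w(t := y) ` {..<t} = w ` {..<t}" for y
    by (intro image_cong) auto
  have ed: "edge (w(t := y)) ` {s\<in>steps k. s < t} = edge w ` {s\<in>steps k. s < t}" for y
    by (intro image_cong) (auto simp: edge_def)
  have dd: "out_degree k (w(t := y)) t = d" if "0 < t" for y
    using that by (simp add: d_def out_degree_def ed)
  have sum_fresh: "(\<Sum>y<n. if y \<notin> w ` {..<t} then q ^ 16 else q\<^sup>2) \<le> 1 + ?T * q\<^sup>2"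
  proof -
    have "(\<Sum>y<n. if y \<notin> w ` {..<t} then q ^ 16 else q\<^sup>2)
        \<le> (\<Sum>y<n. q ^ 16 + (if y \<in> w ` {..<t} then q\<^sup>2 else 0))"
      using q by (intro sum_mono) auto
    also have "\<dots> = real n * q ^ 16 + (\<Sum>y\<in>{..<n} \<inter> w ` {..<t}. q\<^sup>2)"
      by (simp only: sum.distrib sum.inter_restrict finite_lessThan) simp
    also have "\<dots> = 1 + real (card ({..<n} \<inter> w ` {..<t})) * q\<^sup>2"
      using q n by simp
    also have "card ({..<n} \<inter> w ` {..<t}) \<le> card {..<t}"
      by (meson card_image_le card_mono finite_imageI finite_lessThan inf_le2 order_trans)
    then have "real (card ({..<n} \<inter> w ` {..<t})) \<le> ?T" using t by simp
    finally show ?thesis by (simp add: mult_right_mono)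
  qed
  have Tq: "0 \<le> ?T * q" "q\<^sup>2 \<le> ?T * q" "?T * q\<^sup>2 \<le> ?T * q"
  proof -
    have "q\<^sup>2 \<le> q" using q by (simp add: power2_eq_square mult_left_le)
    moreover have "1 * q \<le> ?T * q" using q by (intro mult_right_mono) auto
    ultimately show "0 \<le> ?T * q" "q\<^sup>2 \<le> ?T * q" "?T * q\<^sup>2 \<le> ?T * q"
      using q by (linarith, linarith, intro mult_left_mono) auto
  qed
  show ?thesis
  proof (cases "t \<in> steps k")
    case False
    then have "(\<Sum>y<n. step_weight k q \<eta> (w(t := y)) t)
        = (\<Sum>y<n. if y \<notin> w ` {..<t} then q ^ 16 else q\<^sup>2)"
      unfolding step_weight_def upd by simp
    then show ?thesis using sum_fresh Tq by linarith
  next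
    case True
    have t0: "0 < t" using True by (rule steps_pos)
    have Yfin: "finite Y" unfolding Y_def
    proof (rule finite_subset)
      show "{y. (w (t - 1), y) \<in> edge w ` {s\<in>steps k. s < t}}
          \<subseteq> snd ` (edge w ` {s\<in>steps k. s < t})"
        by (metis (no_types, lifting) image_eqI mem_Collect_eq snd_conv subsetI)
    qed auto
    have "bij_betw (\<lambda>y. (w (t - 1), y)) Y {e\<in>edge w ` {s\<in>steps k. s < t}. fst e = w (t - 1)}"
      by (rule bij_betw_byWitness[where f' = snd]) (auto simp: Y_def simp del: One_nat_def, (metis fst_conv image_eqI mem_Collect_eq prod.collapse)+)
    then have cY: "card Y = d"
      by (simp add: d_def out_degree_def bij_betw_same_card)
    have dT: "real d \<le> ?T"
    proof -
      have "d \<le> card (edge w ` {s\<in>steps k. s < t})"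
        unfolding d_def out_degree_def by (intro card_mono) auto
      also have "\<dots> \<le> card {s\<in>steps k. s < t}" by (intro card_image_le) auto
      also have "\<dots> \<le> card (steps k)" by (intro card_mono) auto
      finally show ?thesis by (simp add: card_steps)
    qed
    have new: "edge (w(t := y)) t = (w (t - 1), y)" for y
      using t0 by (auto simp: edge_def)
    let ?c = "if d = 0 then 1 else q\<^sup>2"
    have le: "step_weight k q \<eta> (w(t := y)) t
        \<le> (if y \<notin> w ` {..<t} then q ^ 16 else q\<^sup>2) * ?c + (if y \<in> Y then \<rho> else 0)" for y
      unfolding step_weight_def upd ed new dd[OF t0] using True q \<eta> \<rho>0
      by (auto simp: Y_def \<rho>_def mult_le_one intro: add_increasing)
    have "(\<Sum>y<n. step_weight k q \<eta> (w(t := y)) t)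
        \<le> (\<Sum>y<n. (if y \<notin> w ` {..<t} then q ^ 16 else q\<^sup>2) * ?c + (if y \<in> Y then \<rho> else 0))"
      by (intro sum_mono le)
    also have "\<dots> = (\<Sum>y<n. if y \<notin> w ` {..<t} then q ^ 16 else q\<^sup>2) * ?c
        + (\<Sum>y\<in>{..<n} \<inter> Y. \<rho>)"
      by (simp only: sum.distrib sum_distrib_right sum.inter_restrict finite_lessThan)
    also have "\<dots> \<le> (1 + ?T * q\<^sup>2) * ?c + real d * \<rho>"
    proof (intro add_mono mult_right_mono sum_fresh)
      have "card ({..<n} \<inter> Y) \<le> d" unfolding cY[symmetric] using Yfin by (intro card_mono) auto
      then show "(\<Sum>y\<in>{..<n} \<inter> Y. \<rho>) \<le> real d * \<rho>" using \<rho>0 by (simp add: mult_right_mono)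
    qed auto
    also have "\<dots> \<le> 1 + 3 * ?T * q"
    proof -
      consider "d = 0" | "d = 1" | "2 \<le> d" by linarith
      then show ?thesis
      proof cases
        case 1
        then show ?thesis using Tq q by (simp del: of_nat_mult mult_Suc_right)
      next
        case 2
        have "(1 + ?T * q\<^sup>2) * q\<^sup>2 = q\<^sup>2 + ?T * q\<^sup>2 * q\<^sup>2" by (simp add: algebra_simps)
        also have "\<dots> \<le> q\<^sup>2 + ?T * q\<^sup>2 * 1"
          using q by (intro add_left_mono mult_left_mono) (auto intro: power_le_one)
        finally have "(1 + ?T * q\<^sup>2) * q\<^sup>2 \<le> 3 * ?T * q" using Tq by linarith
        then show ?thesis using 2 by (simp add: \<rho>_def del: of_nat_mult mult_Suc_right)
      next
        case 3
        have "(1 + ?T * q\<^sup>2) * q\<^sup>2 = q\<^sup>2 + ?T * q\<^sup>2 * q\<^sup>2" by (simp add: algebra_simps)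
        also have "\<dots> \<le> q\<^sup>2 + ?T * q\<^sup>2 * 1"
          using q by (intro add_left_mono mult_left_mono) (auto intro: power_le_one)
        finally have 1: "(1 + ?T * q\<^sup>2) * q\<^sup>2 \<le> ?T * q + ?T * q" using Tq by linarith
        have 2: "real d * q \<le> ?T * q" using dT q by (intro mult_right_mono) auto
        have "0 \<le> \<eta> * real d" using \<eta> by simp
        then have "\<eta> * real d \<le> exp (2 * \<eta> * real d)"
          using exp_ge_add_one_self[of "2 * \<eta> * real d"] by linarith
        then have "\<eta> * real d * exp (- (2 * \<eta> * real d)) \<le> 1"
          using \<eta> by (simp add: exp_minus field_simps)
        then show ?thesis using 1 2 3 q by (simp add: \<rho>_def algebra_simps del: of_nat_mult mult_Suc_right)
      qed
    qed
    finally show ?thesis .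
  qed
qed


section \<open>Sinks, branching and the total weight of a quadruple\<close>

lemma walk_weight_nonneg: "0 \<le> \<eta> \<Longrightarrow> 0 \<le> walk_weight n k \<eta> w"
  unfolding walk_weight_def by auto

text \<open>
  A vertex that is never left is the end of a walk, and the edge leading to it has to be
  covered by a second walk that ends there as well.
\<close>

lemma card_sinks_le:
  assumes k: "0 < k" and cov: "edges_covered_twice k w"
  shows "card (w ` {..<4 * Suc k} - fst ` edge w ` steps k) \<le> 2"
proof -
  let ?Z = "w ` {..<4 * Suc k} - fst ` edge w ` steps k"
  let ?L = "(\<lambda>b. b * Suc k + k) ` {..<4}"
  \<comment> \<open>Any position that is not the end of a walk is followed by a step leaving its
    vertex.\<close>
  have last: "t \<in> ?L" if t: "t < 4 * Suc k" "w t \<in> ?Z" for t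
  proof -
    have "Suc t \<notin> steps k"
      using t by (force simp: edge_def)
    then have "Suc t mod Suc k = 0"
    proof (cases "Suc t = 4 * Suc k")
      case True
      then show ?thesis by (simp only: mod_mult_self2_is_0)
    next
      case False
      with \<open>Suc t \<notin> steps k\<close> t show ?thesis unfolding steps_def by simp
    qed
    then obtain c where c: "Suc t = Suc k * c" by auto
    then have "0 < c" by (cases c) auto
    then obtain b where b: "c = Suc b" by (cases c) auto
    have "Suc k * c \<le> Suc k * 4" using c t by linarith
    then have "c \<le> 4" by (simp only: Suc_mult_le_cancel1)
    then show ?thesis using b c by (intro image_eqI[of _ _ b]) (auto simp: algebra_simps)
  qed
  have two: "2 \<le> card {t\<in>?L. w t = z}" if z: "z \<in> ?Z" for z
  proof -
    obtain t where t: "t < 4 * Suc k" "w t = z" using z by auto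
    then obtain b where b: "t = b * Suc k + k" using last[of t] z by auto
    \<comment> \<open>Because \<open>0 < k\<close>, the end of a walk is itself a step, so its edge
      is subject to the covering condition.\<close>
    have "t mod Suc k = k" unfolding b by (simp del: mult_Suc_right)
    then have tP: "t \<in> steps k" using t k by (auto simp: steps_def)
    have "2 \<le> card {s\<in>steps k. edge w s = edge w t}"
      using cov tP unfolding edges_covered_twice_def by auto
    also have "\<dots> \<le> card {s\<in>?L. w s = z}"
    proof (intro card_mono subsetI)
      fix s assume s: "s \<in> {s\<in>steps k. edge w s = edge w t}"
      then have "w s = z" using t by (auto simp: edge_def)
      then show "s \<in> {s\<in>?L. w s = z}" using last[of s] s z steps_less by auto
    qed auto
    finally show ?thesis .
  qed
  \<comment> \<open>The four end positions are distributed over the sinks, at least two to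
    each.\<close>
  have "2 * card ?Z = (\<Sum>z\<in>?Z. 2)" by simp
  also have "\<dots> \<le> (\<Sum>z\<in>?Z. card {t\<in>?L. w t = z})" by (intro sum_mono two)
  also have "\<dots> = card (\<Union>z\<in>?Z. {t\<in>?L. w t = z})"
    by (subst card_UN_disjoint) auto
  also have "\<dots> \<le> card ?L" by (intro card_mono) auto
  also have "\<dots> \<le> 4" by (rule order_trans[OF card_image_le]) auto
  finally show ?thesis by simp
qed

lemma sum_card_fibres:
  assumes "finite E"
  shows "(\<Sum>x\<in>f ` E. card {e\<in>E. f e = x}) = card E"
  using sum.image_gen[OF assms, of "\<lambda>_. 1::nat" f] by simp

lemma card_eq_fibre_sum:
  assumes "finite E"
  shows "card E = card (f ` E) + (\<Sum>x\<in>f ` E. card {e\<in>E. f e = x} - 1)"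
proof -
  have "(\<Sum>x\<in>f ` E. card {e\<in>E. f e = x}) = (\<Sum>x\<in>f ` E. 1 + (card {e\<in>E. f e = x} - 1))"
  proof (intro sum.cong refl)
    fix x assume "x \<in> f ` E"
    then have "0 < card {e\<in>E. f e = x}" using assms by (auto simp: card_gt_0_iff)
    then show "card {e\<in>E. f e = x} = 1 + (card {e\<in>E. f e = x} - 1)" by simp
  qed
  then show ?thesis by (simp only: sum_card_fibres[OF assms] sum.distrib) simp
qed

lemma card_in_big_fibres_le:
  assumes "finite E"
  shows "card {e\<in>E. 2 \<le> card {e'\<in>E. f e' = f e}} \<le> 2 * (card E - card (f ` E))"
proof -
  let ?d = "\<lambda>x. card {e\<in>E. f e = x}"
  let ?B = "{x\<in>f ` E. 2 \<le> ?d x}"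
  have "{e\<in>E. 2 \<le> ?d (f e)} = (\<Union>x\<in>?B. {e\<in>E. f e = x})" by auto
  then have "card {e\<in>E. 2 \<le> ?d (f e)} = (\<Sum>x\<in>?B. ?d x)"
    using assms by (simp only:) (subst card_UN_disjoint, auto)
  also have "\<dots> \<le> (\<Sum>x\<in>?B. 2 * (?d x - 1))" by (intro sum_mono) auto
  also have "\<dots> \<le> (\<Sum>x\<in>f ` E. 2 * (?d x - 1))" using assms by (intro sum_mono2) auto
  also have "\<dots> = 2 * (card E - card (f ` E))"
    using card_eq_fibre_sum[OF assms, of f] by (simp add: sum_distrib_left)
  finally show ?thesis .
qed

text \<open>The excess of one fibre is at most the total excess.\<close>

lemma card_fibre_le:
  assumes "finite E"
  shows "card {e\<in>E. f e = x} \<le> card E - card (f ` E) + 1"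
proof (cases "x \<in> f ` E")
  case True
  have "card {e\<in>E. f e = x} - 1 \<le> (\<Sum>x\<in>f ` E. card {e\<in>E. f e = x} - 1)"
    using assms True by (intro member_le_sum[of x]) auto
  then show ?thesis using card_eq_fibre_sum[OF assms, of f] by simp
next
  case False
  then have "{e\<in>E. f e = x} = {}" by auto
  then show ?thesis by (simp only: card.empty)
qed

text \<open>
  With \<open>v\<close> vertices, \<open>e\<close> edges and \<open>Br\<close> additional edges leaving a vertex, the bound on the sinks
  gives \<open>Br + v \<le> e + 2\<close>, which pays for all powers of \<open>q\<close> up to the global factor \<open>q ^ 38\<close>.
\<close>

lemma walk_weight_le_prod_step_weight:
  assumes q: "0 < q" "q \<le> 1" "q ^ 16 = 1 / real n" and \<eta>: "0 < \<eta>" "\<eta> \<le> 1"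
    and k: "0 < k" and small: "exp (8 * \<eta> * real k) \<le> 1 / q\<^sup>2"
  shows "q ^ 38 * walk_weight n k \<eta> w \<le> (\<Prod>t<4 * Suc k. step_weight k q \<eta> w t)"
proof (cases "edges_covered_twice k w")
  case False
  then show ?thesis using q \<eta>
    by (auto simp: walk_weight_def intro!: prod_nonneg step_weight_nonneg)
next
  case True
  define P where "P = steps k"
  define T where "T = 4 * Suc k"
  define E where "E = edge w ` P"
  define V where "V = w ` {..<T}"
  define d where "d = out_degree k w"
  define fresh where "fresh t \<longleftrightarrow> w t \<notin> w ` {..<t}" for t
  define new where "new t \<longleftrightarrow> edge w t \<notin> edge w ` {s\<in>P. s < t}" for t
  \<comment> \<open>The positions in \<open>FR\<close>, \<open>NF\<close>, \<open>BR\<close> and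
    \<open>R2\<close> will pay 16, 2, 2 and 1 powers of \<open>q\<close>; those in \<open>L\<close>,
    the third and later uses of edges, pay \<eta> and the exponential.\<close>
  define FR where "FR = {t\<in>{..<T}. fresh t}"
  define NF where "NF = {t\<in>{..<T}. \<not> fresh t \<and> (t \<in> P \<longrightarrow> new t)}"
  define BR where "BR = {t\<in>P. new t \<and> d t \<noteq> 0}"
  define R2 where "R2 = {t\<in>P. occ P (edge w) t = 1 \<and> 2 \<le> d t}"
  define L where "L = {t\<in>P. \<not> new t \<and> occ P (edge w) t \<noteq> 1}"
  define Br where "Br = card E - card (fst ` E)"
  have fin: "finite P" "finite E" by (auto simp: P_def E_def)
  have P_sub: "P \<subseteq> {..<T}" using steps_less by (auto simp: P_def T_def simp del: mult_Suc_right)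
  have new_occ: "new t \<longleftrightarrow> occ P (edge w) t = 0" for t
    unfolding new_def by (simp add: occ_eq_0_iff fin)
  have fresh_new: "new t" if "t \<in> P" "fresh t" for t
    using that by (force simp: new_def fresh_def edge_def)
  \<comment> \<open>Thus \<open>d t = 0\<close> marks the first departure from a vertex, and such
    positions are counted by the distinct sources of edges.\<close>
  have d0: "d t = 0 \<longleftrightarrow> w (t - 1) \<notin> (\<lambda>s. w (s - 1)) ` {s\<in>P. s < t}" for t
  proof -
    have "d t = 0 \<longleftrightarrow> {e\<in>edge w ` {s\<in>P. s < t}. fst e = w (t - 1)} = {}"
      unfolding d_def out_degree_def P_def by (subst card_eq_0_iff) auto
    then show ?thesis by (auto simp: edge_def image_iff)
  qed
  have cFR: "card FR = card V"
  proof -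
    have "{s\<in>{..<T}. s < t} = {..<t}" if "t < T" for t using that by auto
    then have "FR = {t\<in>{..<T}. w t \<notin> w ` {s\<in>{..<T}. s < t}}"
      unfolding FR_def fresh_def by auto
    then show ?thesis unfolding V_def by (simp only: card_first_occurrences finite_lessThan)
  qed
  have cnew: "card {t\<in>P. new t} = card E"
    unfolding E_def new_def by (rule card_first_occurrences) (rule fin)
  \<comment> \<open>The positions in \<open>NF\<close> or \<open>FR\<close> are exactly the four
    starting points and the first uses of edges.\<close>
  have cNF: "card NF + card V = card E + 4"
  proof -
    have "NF \<union> FR = ({..<T} - P) \<union> {t\<in>P. new t}" "NF \<inter> FR = {}"
      using fresh_new P_sub unfolding NF_def FR_def by auto
    then have "card NF + card FR = card (({..<T} - P) \<union> {t\<in>P. new t})"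
      by (subst card_Un_disjoint[symmetric]) (auto simp: NF_def FR_def)
    also have "\<dots> = card ({..<T} - P) + card {t\<in>P. new t}"
      using fin by (intro card_Un_disjoint) auto
    also have "card ({..<T} - P) = 4"
      using P_sub fin by (simp add: card_Diff_subset card_steps P_def T_def)
    finally show ?thesis using cFR cnew by simp
  qed
  have cBR: "card BR = Br"
  proof -
    have "fst ` E = (\<lambda>s. w (s - 1)) ` P" by (simp add: E_def image_image edge_def)
    then have "card (fst ` E) = card {t\<in>P. d t = 0}"
      unfolding d0 by (simp only: card_first_occurrences[OF fin(1), symmetric])
    moreover have "{t\<in>P. new t} = BR \<union> {t\<in>P. d t = 0}"
    proof -
      have "new t" if "t \<in> P" "d t = 0" for t
        using that unfolding d0 new_def by (auto simp: edge_def)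
      then show ?thesis unfolding BR_def by auto
    qed
    then have "card E = card BR + card {t\<in>P. d t = 0}"
      unfolding cnew[symmetric] using fin by (subst card_Un_disjoint[symmetric]) (auto simp: BR_def)
    ultimately show ?thesis by (simp add: Br_def)
  qed
  have Brle: "Br + card V \<le> card E + 2"
  proof -
    have "fst ` E \<subseteq> V" using P_sub by (auto simp: E_def V_def edge_def)
    moreover have "card (V - fst ` E) \<le> 2"
      using card_sinks_le[OF k True] by (simp add: V_def E_def P_def T_def)
    moreover have "card (fst ` E) \<le> card E" using fin by (intro card_image_le)
    moreover have "card (fst ` E) \<le> card V"
      using \<open>fst ` E \<subseteq> V\<close> by (intro card_mono) (auto simp: V_def)
    ultimately show ?thesis using fin by (simp add: Br_def card_Diff_subset)
  qed
  have d_le: "d t \<le> card {e\<in>E. fst e = w (t - 1)}" for t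
    unfolding d_def out_degree_def E_def P_def by (intro card_mono) auto
  have twice: "bij_betw (edge w) {t\<in>P. occ P (edge w) t = 1} E"
    unfolding E_def
  proof (rule bij_betw_occ[OF fin(1)])
    fix e assume "e \<in> edge w ` P"
    then have "2 \<le> card {s\<in>P. edge w s = e}"
      using True unfolding edges_covered_twice_def P_def by auto
    then show "1 < card {s\<in>P. edge w s = e}" by simp
  qed
  \<comment> \<open>Each edge has one second use. If there is a choice at that moment, the source of
    the edge has at least two outgoing edges, so big fibres of \<open>fst\<close> bound the number
    of such edges.\<close>
  have cR2: "card R2 \<le> 2 * Br"
  proof -
    have "inj_on (edge w) R2"
      by (rule inj_on_subset[OF bij_betw_imp_inj_on[OF twice]]) (auto simp: R2_def)
    then have "card R2 = card (edge w ` R2)" by (simp add: card_image)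
    also have "\<dots> \<le> card {e\<in>E. 2 \<le> card {e'\<in>E. fst e' = fst e}}"
    proof (intro card_mono subsetI)
      fix e assume "e \<in> edge w ` R2"
      then obtain t where t: "t \<in> P" "2 \<le> d t" "e = edge w t" by (auto simp: R2_def)
      then show "e \<in> {e\<in>E. 2 \<le> card {e'\<in>E. fst e' = fst e}}"
        using d_le[of t] by (auto simp: E_def edge_def)
    qed (use fin in auto)
    also have "\<dots> \<le> 2 * Br" unfolding Br_def by (rule card_in_big_fibres_le) (rule fin)
    finally show ?thesis .
  qed
  have cL: "card L = 4 * k - 2 * card E"
  proof -
    have "card P = card L + card {t\<in>P. new t} + card {t\<in>P. occ P (edge w) t = 1}"
    proof -
      have "P = L \<union> ({t\<in>P. new t} \<union> {t\<in>P. occ P (edge w) t = 1})" by (auto simp: L_def)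
      then have "card P = card (L \<union> ({t\<in>P. new t} \<union> {t\<in>P. occ P (edge w) t = 1}))" by simp
      also have "\<dots> = card L + card ({t\<in>P. new t} \<union> {t\<in>P. occ P (edge w) t = 1})"
        using fin by (intro card_Un_disjoint) (auto simp: L_def)
      also have "card ({t\<in>P. new t} \<union> {t\<in>P. occ P (edge w) t = 1})
          = card {t\<in>P. new t} + card {t\<in>P. occ P (edge w) t = 1}"
        using fin by (intro card_Un_disjoint) (auto simp: new_occ)
      finally show ?thesis by simp
    qed
    then show ?thesis using bij_betw_same_card[OF twice] cnew by (simp add: P_def card_steps)
  qed
  define a where "a t = (if t \<in> FR then 16 else 0) + (if t \<in> NF then 2 else 0)
     + (if t \<in> BR then 2 else 0) + (if t \<in> R2 then 1 else (0::nat))" for t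
  have sw: "step_weight k q \<eta> w t
      = q ^ a t * (if t \<in> L then \<eta> * exp (- 2 * \<eta> * real (d t)) else 1)" if "t < T" for t
  proof -
    have "step_weight k q \<eta> w t =
     (if t \<notin> P then (if fresh t then q ^ 16 else q\<^sup>2)
      else if new t then (if fresh t then q ^ 16 else q\<^sup>2) * (if d t = 0 then 1 else q\<^sup>2)
      else if occ P (edge w) t = 1 then (if d t \<le> 1 then 1 else q)
      else \<eta> * exp (- 2 * \<eta> * real (d t)))"
      unfolding step_weight_def fresh_def new_def d_def P_def ..
    moreover have "q * q = q\<^sup>2" "q * (q * q ^ 16) = q ^ 18" "q * (q * q\<^sup>2) = q ^ 4"
      by (simp_all add: numeral_eq_Suc)
    ultimately show ?thesis
      using that fresh_new[of t]
      by (cases "t \<in> P"; cases "fresh t"; cases "new t")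
        (auto simp: a_def FR_def NF_def BR_def R2_def L_def new_occ power_add[symmetric])
  qed
  have sum_a: "(\<Sum>t<T. a t) = 16 * card FR + 2 * card NF + 2 * card BR + card R2"
  proof -
    have c: "(\<Sum>t<T. if t \<in> S then c else 0) = c * card S" if "S \<subseteq> {..<T}" for S and c :: nat
    proof -
      have "{..<T} \<inter> S = S" using that by auto
      then show ?thesis by (subst sum.inter_restrict[symmetric]) auto
    qed
    have "FR \<subseteq> {..<T}" "NF \<subseteq> {..<T}" "BR \<subseteq> {..<T}" "R2 \<subseteq> {..<T}"
      using P_sub by (auto simp: FR_def NF_def BR_def R2_def)
    then show ?thesis unfolding a_def sum.distrib by (simp add: c)
  qed
  \<comment> \<open>Every out-degree is at most \<open>Br + 1\<close> and \<open>L\<close> has at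
    most \<open>4 * k\<close> elements, so the exponentials lose at most
    \<open>exp (8 * \<eta> * k)\<close> to the power \<open>Br + 1\<close>; the hypothesis
    \<open>small\<close> converts this into powers of \<open>q\<close>.\<close>
  have exp_le: "q ^ (2 * (Br + 1)) \<le> exp (- 2 * \<eta> * (\<Sum>t\<in>L. real (d t)))"
  proof -
    have "(\<Sum>t\<in>L. real (d t)) \<le> (\<Sum>t\<in>L. real (Br + 1))"
      using d_le card_fibre_le[OF fin(2), of fst, folded Br_def]
      by (intro sum_mono of_nat_mono) (meson order_trans)
    also have "\<dots> = real (card L) * real (Br + 1)" by simp
    also have "card L \<le> 4 * k" unfolding cL by simp
    then have "real (card L) * real (Br + 1) \<le> real (4 * k) * real (Br + 1)"
      by (intro mult_right_mono) (simp_all only: of_nat_le_iff of_nat_0_le_iff)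
    finally have "2 * \<eta> * (\<Sum>t\<in>L. real (d t)) \<le> 2 * \<eta> * (real (4 * k) * real (Br + 1))"
      using \<eta> by (intro mult_left_mono) auto
    also have "\<dots> = (8 * \<eta> * real k) * real (Br + 1)" by simp
    finally have "exp (2 * \<eta> * (\<Sum>t\<in>L. real (d t))) \<le> exp (real (Br + 1) * (8 * \<eta> * real k))"
      by (simp add: mult.commute)
    also have "\<dots> = exp (8 * \<eta> * real k) ^ (Br + 1)" by (rule exp_of_nat_mult)
    also have "\<dots> \<le> (1 / q\<^sup>2) ^ (Br + 1)" by (intro power_mono small) auto
    also have "\<dots> = 1 / q ^ (2 * (Br + 1))"
      by (simp only: power_divide power_mult power_one)
    finally show ?thesis using q by (simp add: exp_minus field_simps)
  qed
  have "q ^ 38 * walk_weight n k \<eta> w = q ^ (38 + 16 * card E) * \<eta> ^ card L"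
    using True q(3) by (simp add: walk_weight_def cL E_def P_def power_add power_mult)
  also have "\<dots> \<le> q ^ ((\<Sum>t<T. a t) + 2 * (Br + 1)) * \<eta> ^ card L"
  proof (intro mult_right_mono power_decreasing)
    \<comment> \<open>With v vertices and e edges the exponent is at most 14 v + 2 e + 6 Br + 10.
      Using Br + v \<le> e + 2 six times and v \<le> e + 2 eight times leaves 16 e + 38, where 38 =
      10 + 12 + 16.\<close>
    show "(\<Sum>t<T. a t) + 2 * (Br + 1) \<le> 38 + 16 * card E"
    proof -
      have "(\<Sum>t<T. a t) + 2 * (Br + 1) \<le> 14 * card V + 2 * (card NF + card V) + 6 * Br + 2"
        unfolding sum_a cFR cBR using cR2 by simp
      also have "\<dots> = 8 * card V + 2 * card E + 10 + 6 * (Br + card V)" using cNF by simp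
      also have "\<dots> \<le> 8 * card V + 2 * card E + 10 + 6 * (card E + 2)" using Brle by simp
      also have "\<dots> \<le> 8 * (card E + 2) + 2 * card E + 10 + 6 * (card E + 2)" using Brle by simp
      finally show ?thesis by simp
    qed
  qed (use q \<eta> in auto)
  also have "\<dots> = q ^ (\<Sum>t<T. a t) * (\<eta> ^ card L * q ^ (2 * (Br + 1)))"
    by (simp add: power_add)
  also have "\<dots> \<le> q ^ (\<Sum>t<T. a t) * (\<eta> ^ card L * exp (- 2 * \<eta> * (\<Sum>t\<in>L. real (d t))))"
    by (intro mult_left_mono exp_le) (use q \<eta> in auto)
  also have "\<dots> = (\<Prod>t<T. q ^ a t) * (\<Prod>t\<in>L. \<eta> * exp (- 2 * \<eta> * real (d t)))"
    using fin by (simp add: power_sum prod.distrib sum_distrib_left exp_sum[symmetric] L_def)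
  also have "(\<Prod>t\<in>L. \<eta> * exp (- 2 * \<eta> * real (d t)))
      = (\<Prod>t<T. if t \<in> L then \<eta> * exp (- 2 * \<eta> * real (d t)) else 1)"
  proof -
    have "{..<T} \<inter> L = L" using P_sub by (auto simp: L_def)
    then show ?thesis by (subst prod.inter_restrict[symmetric]) auto
  qed
  also have "(\<Prod>t<T. q ^ a t) * \<dots> = (\<Prod>t<T. step_weight k q \<eta> w t)"
    by (simp add: sw prod.distrib)
  finally show ?thesis unfolding T_def .
qed

text \<open>For \<open>k\<close> of order \<open>ln n\<close> the exponential stays bounded, and
  \<open>1 / q ^ 38\<close> is \<open>n powr (38 / 16) = n powr (19 / 8)\<close>.\<close>

lemma sum_walk_weight_le:
  assumes q: "0 < q" "q \<le> 1" "q ^ 16 = 1 / real n" and n: "0 < n" and \<eta>: "0 < \<eta>" "\<eta> \<le> 1"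
    and k: "0 < k" and small: "exp (8 * \<eta> * real k) \<le> 1 / q\<^sup>2"
  shows "(\<Sum>w\<in>PiE {..<4 * Suc k} (\<lambda>_. {..<n}). walk_weight n k \<eta> w)
      \<le> exp (3 * (real (4 * Suc k))\<^sup>2 * q) / q ^ 38"
proof -
  let ?T = "4 * Suc k"
  have "q ^ 38 * (\<Sum>w\<in>PiE {..<?T} (\<lambda>_. {..<n}). walk_weight n k \<eta> w)
      \<le> (\<Sum>w\<in>PiE {..<?T} (\<lambda>_. {..<n}). \<Prod>t<?T. step_weight k q \<eta> w t)"
    unfolding sum_distrib_left
    by (intro sum_mono walk_weight_le_prod_step_weight q \<eta> k small)
  also have "\<dots> \<le> (1 + 3 * real ?T * q) ^ ?T"
    using q \<eta> n by (intro sum_prod_prefix_le sum_step_weight_le step_weight_nonneg step_weight_prefix) auto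
  also have "\<dots> \<le> exp (3 * real ?T * q) ^ ?T"
    using q by (intro power_mono exp_ge_add_one_self) auto
  also have "\<dots> = exp (3 * (real ?T)\<^sup>2 * q)"
    by (simp only: exp_of_nat_mult[symmetric] power2_eq_square mult_ac)
  finally show ?thesis using q by (simp add: field_simps)
qed

section \<open>Rank-one perturbations\<close>

lemma poly_char_poly_mat:
  fixes a :: "nat \<Rightarrow> nat \<Rightarrow> 'a :: field"
  shows "poly (char_poly (mat n n (\<lambda>(i, j). a i j))) z
    = det (mat n n (\<lambda>(i, j). (if i = j then z else 0) - a i j))"
proof -
  have "poly (char_poly (mat n n (\<lambda>(i, j). a i j))) z
      = det (- (char_matrix (mat n n (\<lambda>(i, j). a i j)) z))"
    by (rule char_poly_matrix[of _ n]) auto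
  also have "- (char_matrix (mat n n (\<lambda>(i, j). a i j)) z)
      = mat n n (\<lambda>(i, j). (if i = j then z else 0) - a i j)"
    by (rule eq_matI) (auto simp: char_matrix_def)
  finally show ?thesis .
qed

text \<open>Conjugation by the unipotent matrix \<open>E\<close>, which subtracts column 0 from all
  other columns, makes the matrix lower triangular with diagonal
  \<open>1 - (\<Sum>i<n. y i), 1, ..., 1\<close>.\<close>

lemma det_one_minus_const_cols:
  fixes y :: "nat \<Rightarrow> 'a :: idom"
  shows "det (mat n n (\<lambda>(i, j). (if i = j then 1 else 0) - y i)) = 1 - (\<Sum>i<n. y i)"
proof (cases n)
  case 0
  then show ?thesis by (simp add: det_def)
next
  case (Suc m)
  define W where "W = mat n n (\<lambda>(i, j). (if i = j then 1 else 0) - y i)"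
  define E where "E = mat n n (\<lambda>(i, j). (if i = j then 1 else 0) - (if i = 0 \<and> j \<noteq> 0 then 1 else (0::'a)))"
  define L where "L = mat n n (\<lambda>(i, j). if j = 0 then (if i = 0 then 1 - (\<Sum>i<n. y i) else - y i)
     else (if i = j then 1 else 0))"
  have n0: "0 < n" using Suc by simp
  have carr: "W \<in> carrier_mat n n" "E \<in> carrier_mat n n" "L \<in> carrier_mat n n"
    by (auto simp: W_def E_def L_def)
  have "W * E = E * L"
  proof (rule eq_matI)
    fix i j assume "i < dim_row (E * L)" "j < dim_col (E * L)"
    then have ij: "i < n" "j < n" using carr by auto
    have sum_y: "(\<Sum>i<n. y i) = y 0 + (\<Sum>i\<in>{1..<n}. y i)"
      unfolding lessThan_atLeast0 using Suc by (subst sum.atLeast_Suc_lessThan) auto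
    have sum_split: "(\<Sum>l\<in>{0..<n}. f l) = f 0 + (\<Sum>l\<in>{1..<n}. f l)" for f :: "nat \<Rightarrow> 'a"
      using Suc by (subst sum.atLeast_Suc_lessThan) auto
    have "(W * E) $$ (i, j) = (\<Sum>l\<in>{0..<n}. W $$ (i, l) * E $$ (l, j))"
      using carr ij by (simp add: scalar_prod_def)
    also have "\<dots> = (if j = 0 then W $$ (i, 0) else W $$ (i, j) - W $$ (i, 0))"
    proof -
      have "(\<Sum>l\<in>{0..<n}. W $$ (i, l) * E $$ (l, j))
         = (\<Sum>l\<in>{0..<n}. (if l = j then W $$ (i, l) else 0)
             - (if l = 0 then (if j \<noteq> 0 then W $$ (i, l) else 0) else 0))"
        using ij by (intro sum.cong) (auto simp: E_def)
      then show ?thesis using ij by (simp add: sum_subtractf)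
    qed
    finally have 1: "(W * E) $$ (i, j) = (if j = 0 then W $$ (i, 0) else W $$ (i, j) - W $$ (i, 0))" .
    have "(E * L) $$ (i, j) = (\<Sum>l\<in>{0..<n}. E $$ (i, l) * L $$ (l, j))"
      using carr ij by (simp add: scalar_prod_def)
    also have "\<dots> = L $$ (i, j) - (if i = 0 then (\<Sum>l\<in>{1..<n}. L $$ (l, j)) else 0)"
    proof -
      have "(\<Sum>l\<in>{0..<n}. E $$ (i, l) * L $$ (l, j))
         = (\<Sum>l\<in>{0..<n}. (if l = i then L $$ (l, j) else 0)
             - (if i = 0 then (if l = 0 then 0 else L $$ (l, j)) else 0))"
        using ij by (intro sum.cong) (auto simp: E_def)
      also have "\<dots> = L $$ (i, j) - (if i = 0 then (\<Sum>l\<in>{0..<n}. if l = 0 then 0 else L $$ (l, j)) else 0)"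
        using ij by (simp add: sum_subtractf)
      also have "(\<Sum>l\<in>{0..<n}. if l = 0 then 0 else L $$ (l, j)) = (\<Sum>l\<in>{1..<n}. L $$ (l, j))"
        unfolding sum_split by (auto intro!: sum.cong)
      finally show ?thesis .
    qed
    also have "(\<Sum>l\<in>{1..<n}. L $$ (l, j)) = (if j = 0 then - (\<Sum>l\<in>{1..<n}. y l) else 1)"
    proof -
      have "(\<Sum>l\<in>{1..<n}. L $$ (l, j)) = (\<Sum>l\<in>{1..<n}. if j = 0 then - y l else if l = j then 1 else 0)"
        using ij by (intro sum.cong) (auto simp: L_def)
      then show ?thesis using ij by (auto simp: sum_negf)
    qed
    finally show "(W * E) $$ (i, j) = (E * L) $$ (i, j)"
      unfolding 1 using ij n0 by (auto simp: W_def L_def sum_y)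
  qed (use carr in auto)
  then have "det W * det E = det E * det L" 
    by (simp only: det_mult[OF carr(1,2), symmetric] det_mult[OF carr(2,3), symmetric])
  moreover have "det E = 1"
  proof -
    have "det E = prod_list (diag_mat E)"
      by (rule det_upper_triangular[of _ n]) (auto simp: E_def upper_triangular_def)
    also have "\<dots> = 1" unfolding prod_list_diag_prod by (rule prod.neutral) (auto simp: E_def)
    finally show ?thesis .
  qed
  moreover have "det L = 1 - (\<Sum>i<n. y i)"
  proof -
    have "det L = prod_list (diag_mat L)"
      by (rule det_lower_triangular[of n]) (auto simp: L_def)
    also have "\<dots> = (\<Prod>i\<in>{0..<n}. if i = 0 then 1 - (\<Sum>i<n. y i) else 1)"
      unfolding prod_list_diag_prod by (rule prod.cong) (auto simp: L_def)
    also have "\<dots> = 1 - (\<Sum>i<n. y i)" using Suc by simp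
    finally show ?thesis .
  qed
  ultimately show ?thesis by (simp add: W_def)
qed

text \<open>As \<open>u\<close> is mapped by the matrix to \<open>z\<close> times the all-ones
  vector, subtracting \<open>c\<close> from every entry amounts to multiplication on the right by
  the identity minus a rank-one matrix whose row \<open>i\<close> is constantly
  \<open>c / z * u i\<close>.\<close>

lemma det_minus_const:
  fixes b :: "nat \<Rightarrow> nat \<Rightarrow> 'a :: field"
  assumes u: "\<And>i. i < n \<Longrightarrow> (\<Sum>j<n. b i j * u j) = z" and z: "z \<noteq> 0"
  shows "det (mat n n (\<lambda>(i, j). b i j - c)) = det (mat n n (\<lambda>(i, j). b i j)) * (1 - c / z * (\<Sum>i<n. u i))"
proof -
  let ?B = "mat n n (\<lambda>(i, j). b i j)"
  let ?W = "mat n n (\<lambda>(i, j). (if i = j then 1 else 0) - c / z * u i)"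
  have "?B * ?W = mat n n (\<lambda>(i, j). b i j - c)"
  proof (rule eq_matI)
    fix i j assume "i < dim_row (mat n n (\<lambda>(i, j). b i j - c))" "j < dim_col (mat n n (\<lambda>(i, j). b i j - c))"
    then have ij: "i < n" "j < n" by auto
    then have "(?B * ?W) $$ (i, j) = (\<Sum>l<n. b i l * ((if l = j then 1 else 0) - c / z * u l))"
      by (simp add: scalar_prod_def lessThan_atLeast0)
    also have "\<dots> = (\<Sum>l<n. (if l = j then b i l else 0) - c / z * (b i l * u l))"
      by (intro sum.cong) (auto simp: algebra_simps)
    also have "\<dots> = b i j - c / z * (\<Sum>l<n. b i l * u l)"
      using ij by (simp add: sum_subtractf sum_distrib_left)
    also have "\<dots> = b i j - c" using u[OF ij(1)] z by simp
    finally show "(?B * ?W) $$ (i, j) = mat n n (\<lambda>(i, j). b i j - c) $$ (i, j)" using ij by simp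
  qed auto
  then have "det (mat n n (\<lambda>(i, j). b i j - c)) = det ?B * det ?W"
    using det_mult[of ?B n ?W] by simp
  also have "det ?W = 1 - c / z * (\<Sum>i<n. u i)"
    by (simp add: det_one_minus_const_cols sum_distrib_left)
  finally show ?thesis .
qed

lemma det_nonzero_solve:
  fixes b :: "nat \<Rightarrow> nat \<Rightarrow> 'a :: field"
  assumes "det (mat n n (\<lambda>(i, j). b i j)) \<noteq> 0"
  shows "\<exists>u. \<forall>i<n. (\<Sum>j<n. b i j * u j) = y i"
proof -
  let ?B = "mat n n (\<lambda>(i, j). b i j)"
  have B: "?B \<in> carrier_mat n n" by simp
  obtain C where C: "C \<in> carrier_mat n n" "?B * C = 1\<^sub>m n"
    using det_non_zero_imp_unit[OF B assms, of "()"]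
    unfolding Units_def by (auto simp: ring_mat_def)
  define u where "u = C *\<^sub>v vec n y"
  have uc: "u \<in> carrier_vec n" using C by (auto simp: u_def)
  have Bu: "?B *\<^sub>v u = vec n y"
    unfolding u_def using C B by (subst assoc_mult_mat_vec[symmetric]) auto
  have "(\<Sum>j<n. b i j * u $ j) = y i" if "i < n" for i
    using that uc arg_cong[OF Bu, of "\<lambda>v. vec_index v i"]
    by (simp add: scalar_prod_def lessThan_atLeast0)
  then show ?thesis by blast
qed

lemma det_zero_kernel:
  fixes b :: "nat \<Rightarrow> nat \<Rightarrow> 'a :: field"
  assumes "det (mat n n (\<lambda>(i, j). b i j)) = 0"
  shows "\<exists>v. (\<exists>i<n. v i \<noteq> 0) \<and> (\<forall>i<n. (\<Sum>j<n. b i j * v j) = 0)"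
proof -
  let ?B = "mat n n (\<lambda>(i, j). b i j)"
  have B: "?B \<in> carrier_mat n n" by simp
  obtain v where v: "v \<in> carrier_vec n" "v \<noteq> 0\<^sub>v n" "?B *\<^sub>v v = 0\<^sub>v n"
    using assms det_0_iff_vec_prod_zero_field[OF B] by auto
  have "(\<Sum>j<n. b i j * v $ j) = 0" if "i < n" for i
    using that v(1) arg_cong[OF v(3), of "\<lambda>v. vec_index v i"]
    by (simp add: scalar_prod_def lessThan_atLeast0)
  moreover have "\<exists>i<n. v $ i \<noteq> 0"
  proof (rule ccontr)
    assume "\<not> (\<exists>i<n. v $ i \<noteq> 0)"
    then have "v = 0\<^sub>v n" using v(1) by (intro eq_vecI) auto
    then show False using v(2) by simp
  qed
  ultimately show ?thesis by blast
qed

section \<open>Zeros of polynomials in a disk\<close>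

lemma zorder_poly:
  assumes "p \<noteq> 0"
  shows "zorder (poly p) z = int (order z p)"
proof -
  obtain s where s: "p = [:- z, 1:] ^ order z p * s" "\<not> [:- z, 1:] dvd s"
    using order_decomp[OF assms] by blast
  show ?thesis
  proof (rule zorder_eqI[where S = UNIV and g = "poly s"])
    show "poly s z \<noteq> 0" using s(2) by (simp add: poly_eq_0_iff_dvd)
    show "poly p w = poly s w * (w - z) powi int (order z p)" for w
      by (subst s(1)) simp
  qed (auto intro!: holomorphic_intros)
qed

text \<open>The strict inequality keeps all zeros off the circle; the winding numbers in Rouche's
  theorem are then 1 inside and 0 outside, which turns its weighted sums into counts with
  multiplicity.\<close>

lemma rouche_poly:
  fixes p p0 :: "complex poly"
  assumes \<rho>: "0 < \<rho>" and less: "\<And>z. dist c z = \<rho> \<Longrightarrow> cmod (poly p z - poly p0 z) < cmod (poly p0 z)"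
  shows "(\<Sum>z | poly p z = 0 \<and> z \<in> ball c \<rho>. order z p) = (\<Sum>z | poly p0 z = 0 \<and> z \<in> ball c \<rho>. order z p0)"
proof -
  have sph: "dist c (c + of_real \<rho>) = \<rho>" using \<rho> by (simp add: dist_norm)
  have nz: "p0 \<noteq> 0" "p \<noteq> 0" using less[OF sph] by auto
  have eq: "(\<lambda>z. poly p0 z + poly (p - p0) z) = poly p" by auto
  have wn: "(\<Sum>z | poly r z = 0. winding_number (circlepath c \<rho>) z * of_int (zorder (poly r) z))
      = of_nat (\<Sum>z | poly r z = 0 \<and> z \<in> ball c \<rho>. order z r)"
    if r: "r \<noteq> 0" "\<And>z. dist c z = \<rho> \<Longrightarrow> poly r z \<noteq> 0" for r
  proof -
    have "(\<Sum>z | poly r z = 0. winding_number (circlepath c \<rho>) z * of_int (zorder (poly r) z))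
        = (\<Sum>z | poly r z = 0. if z \<in> ball c \<rho> then of_nat (order z r) else 0)"
    proof (rule sum.cong[OF refl])
      fix z assume "z \<in> {z. poly r z = 0}"
      then have z: "dist c z \<noteq> \<rho>" using r by auto
      show "winding_number (circlepath c \<rho>) z * of_int (zorder (poly r) z)
          = (if z \<in> ball c \<rho> then of_nat (order z r) else 0)"
      proof (cases "z \<in> ball c \<rho>")
        case True
        then have "winding_number (circlepath c \<rho>) z = 1"
          by (intro winding_number_circlepath) (simp add: dist_norm norm_minus_commute)
        then show ?thesis using True r by (simp add: zorder_poly)
      next
        case False
        then have "winding_number (circlepath c \<rho>) z = 0"
          using z \<rho> by (intro winding_number_zero_outside[where s = "cball c \<rho>"]) auto
        then show ?thesis using False by simp
      qed
    qed
    also have "\<dots> = (\<Sum>z\<in>{z. poly r z = 0} \<inter> ball c \<rho>. of_nat (order z r))"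
      using r by (subst sum.inter_restrict) (auto simp: poly_roots_finite)
    also have "{z. poly r z = 0} \<inter> ball c \<rho> = {z. poly r z = 0 \<and> z \<in> ball c \<rho>}" by auto
    finally show ?thesis by simp
  qed
  have nz': "poly p z \<noteq> 0" "poly p0 z \<noteq> 0" if "dist c z = \<rho>" for z using less[OF that] by auto
  have "(\<Sum>z\<in>{z\<in>UNIV. poly p0 z + poly (p - p0) z = 0}. winding_number (circlepath c \<rho>) z
          * zorder (\<lambda>z. poly p0 z + poly (p - p0) z) z)
      = (\<Sum>z\<in>{z\<in>UNIV. poly p0 z = 0}. winding_number (circlepath c \<rho>) z * zorder (poly p0) z)"
  proof (rule Rouche_theorem)
    show "finite {z \<in> UNIV. poly p0 z + poly (p - p0) z = 0}" "finite {z \<in> UNIV. poly p0 z = 0}"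
      using nz by (auto simp: poly_roots_finite)
    show "\<forall>z\<in>path_image (circlepath c \<rho>). cmod (poly (p - p0) z) < cmod (poly p0 z)"
      using less \<rho> by (auto simp: sphere_def)
  qed (auto intro!: holomorphic_intros)
  then have "(of_nat (\<Sum>z | poly p z = 0 \<and> z \<in> ball c \<rho>. order z p) :: complex)
      = of_nat (\<Sum>z | poly p0 z = 0 \<and> z \<in> ball c \<rho>. order z p0)"
    unfolding eq using wn[OF nz(2) nz'(1)] wn[OF nz(1) nz'(2)] by simp
  then show ?thesis by (simp only: of_nat_eq_iff)
qed

lemma sum_order_eq_1_unique:
  fixes p :: "complex poly"
  assumes "p \<noteq> 0" and "(\<Sum>z | poly p z = 0 \<and> z \<in> S. order z p) = 1"
  shows "\<exists>l\<in>S. order l p = 1 \<and> (\<forall>z\<in>S. poly p z = 0 \<longrightarrow> z = l)"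
proof -
  let ?R = "{z. poly p z = 0 \<and> z \<in> S}"
  have fin: "finite ?R" by (rule finite_subset[OF _ poly_roots_finite[OF assms(1)]]) auto
  have "\<exists>l\<in>?R. order l p = 1 \<and> (\<forall>z\<in>?R. l \<noteq> z \<longrightarrow> order z p = 0)"
    by (rule iffD1[OF sum_eq_1_iff[OF fin] assms(2)])
  then obtain l where l: "l \<in> ?R" "order l p = 1" "\<forall>z\<in>?R. l \<noteq> z \<longrightarrow> order z p = 0"
    by (elim bexE conjE)
  show ?thesis
  proof (intro bexI conjI ballI impI)
    fix z assume "z \<in> S" "poly p z = 0"
    then have "order z p \<noteq> 0" using assms(1) by (simp add: order_root)
    then show "z = l" using l(3) \<open>z \<in> S\<close> \<open>poly p z = 0\<close> by auto
  qed (use l in auto)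
qed


section \<open>Matrix powers and the resolvent\<close>

fun mat_power :: "nat \<Rightarrow> (nat \<Rightarrow> nat \<Rightarrow> complex) \<Rightarrow> nat \<Rightarrow> nat \<Rightarrow> nat \<Rightarrow> complex" where
  "mat_power n a 0 i j = (if i = j then 1 else 0)"
| "mat_power n a (Suc k) i j = (\<Sum>l<n. mat_power n a k i l * a l j)"

text \<open>This is \<open>\<phi>\<^sup>* A ^ k \<phi>\<close> from the overview.\<close>

definition mean_power :: "nat \<Rightarrow> (nat \<Rightarrow> nat \<Rightarrow> complex) \<Rightarrow> nat \<Rightarrow> complex" where
  "mean_power n a k = (\<Sum>i<n. \<Sum>j<n. mat_power n a k i j) / of_nat n"

text \<open>
  Finite Neumann expansion, avoiding any bound on the operator norm of the matrix itself.
\<close>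

lemma resolvent_expansion:
  assumes z: "z \<noteq> 0" and u: "\<And>i. i < n \<Longrightarrow> (\<Sum>j<n. ((if i = j then z else 0) - a i j) * u j) = z * \<beta>"
    and i: "i < n"
  shows "u i = \<beta> * (\<Sum>m<K. (\<Sum>j<n. mat_power n a m i j) / z ^ m)
    + (\<Sum>j<n. mat_power n a K i j * u j) / z ^ K"
proof (induction K)
  case 0
  have "(\<Sum>j<n. mat_power n a 0 i j * u j) = (\<Sum>j<n. if i = j then u j else 0)"
    by (intro sum.cong) auto
  then show ?case using i by simp
next
  case (Suc K)
  have u': "u j = \<beta> + (\<Sum>l<n. a j l * u l) / z" if "j < n" for j
  proof -
    have "z * \<beta> = (\<Sum>l<n. (if j = l then z * u l else 0) - a j l * u l)"
      unfolding u[OF that, symmetric] by (intro sum.cong) (auto simp: algebra_simps)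
    also have "\<dots> = z * u j - (\<Sum>l<n. a j l * u l)" using that by (simp add: sum_subtractf)
    finally show ?thesis using z by (simp add: field_simps)
  qed
  have "(\<Sum>j<n. mat_power n a K i j * u j)
      = (\<Sum>j<n. \<beta> * mat_power n a K i j + (\<Sum>l<n. mat_power n a K i j * a j l * u l) / z)"
    by (intro sum.cong refl, subst u') (auto simp: algebra_simps sum_distrib_left)
  also have "\<dots> = \<beta> * (\<Sum>j<n. mat_power n a K i j)
      + (\<Sum>l<n. \<Sum>j<n. mat_power n a K i j * a j l * u l) / z"
    by (subst sum.swap) (simp add: sum.distrib sum_distrib_left sum_divide_distrib)
  also have "\<dots> = \<beta> * (\<Sum>j<n. mat_power n a K i j) + (\<Sum>l<n. mat_power n a (Suc K) i l * u l) / z"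
    by (simp add: sum_distrib_right)
  finally show ?case using z
    by (subst Suc.IH) (simp add: algebra_simps add_divide_distrib del: mat_power.simps)
qed

text \<open>In the expansion of order \<open>K\<close> the remainder is at most half of the largest
  entry of \<open>u\<close>, because \<open>cmod z ^ K\<close> exceeds twice the row sums of the
  power. Evaluated at the largest entry, it can be absorbed on the left. With
  \<open>\<beta> = 0\<close> the bound says that the kernel of \<open>z - A\<close> is
  trivial.\<close>

lemma resolvent_bound:
  assumes n: "0 < n"
    and pw: "\<And>k i j. k \<le> K \<Longrightarrow> i < n \<Longrightarrow> j < n \<Longrightarrow> cmod (mat_power n a k i j) \<le> real n ^ 2"
    and z: "1 \<le> cmod z" "2 * real n ^ 3 \<le> cmod z ^ K"
    and u: "\<And>i. i < n \<Longrightarrow> (\<Sum>j<n. ((if i = j then z else 0) - a i j) * u j) = z * \<beta>"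
    and i: "i < n"
  shows "cmod (u i) \<le> 2 * cmod \<beta> * real K * real n ^ 3"
proof -
  define U where "U = Max ((\<lambda>i. cmod (u i)) ` {..<n})"
  have U: "cmod (u i) \<le> U" if "i < n" for i using that by (auto simp: U_def)
  have U0: "0 \<le> U" using U[OF i] norm_ge_zero order_trans by blast
  have z0: "z \<noteq> 0" using z by auto
  have row: "cmod (\<Sum>j<n. mat_power n a k i j * v j) \<le> real n ^ 3 * B"
    if "k \<le> K" "i < n" "\<And>j. j < n \<Longrightarrow> cmod (v j) \<le> B" for k i v B
  proof -
    have "cmod (\<Sum>j<n. mat_power n a k i j * v j) \<le> (\<Sum>j<n. real n ^ 2 * B)"
      using that pw by (intro sum_norm_le) (auto simp: norm_mult intro!: mult_mono)
    also have "\<dots> = real n ^ 3 * B" by (simp add: power3_eq_cube power2_eq_square)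
    finally show ?thesis .
  qed
  have "cmod (u i) \<le> cmod \<beta> * real K * real n ^ 3 + U / 2" if i: "i < n" for i
  proof -
    have "cmod (u i) \<le> cmod \<beta> * cmod (\<Sum>m<K. (\<Sum>j<n. mat_power n a m i j) / z ^ m)
        + cmod (\<Sum>j<n. mat_power n a K i j * u j) / cmod z ^ K"
      by (subst resolvent_expansion[OF z0 u i, of K])
         (auto intro!: norm_triangle_mono simp: norm_mult norm_divide norm_power)
    also have "cmod (\<Sum>m<K. (\<Sum>j<n. mat_power n a m i j) / z ^ m) \<le> (\<Sum>m<K. real n ^ 3)"
    proof (intro sum_norm_le)
      fix m assume m: "m \<in> {..<K}"
      have "cmod ((\<Sum>j<n. mat_power n a m i j) / z ^ m) \<le> cmod (\<Sum>j<n. mat_power n a m i j * 1) / 1"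
        unfolding norm_divide norm_power mult_1_right using z z0
        by (intro divide_left_mono) (auto intro!: mult_pos_pos zero_less_power)
      also have "\<dots> \<le> real n ^ 3" using row[of m i "\<lambda>_. 1" 1] m i by simp
      finally show "cmod ((\<Sum>j<n. mat_power n a m i j) / z ^ m) \<le> real n ^ 3" .
    qed
    also have "cmod (\<Sum>j<n. mat_power n a K i j * u j) / cmod z ^ K \<le> (real n ^ 3 * U) / (2 * real n ^ 3)"
      using n z i U U0 by (intro frac_le row) auto
    also have "\<dots> = U / 2" using n by simp
    finally show ?thesis by (simp add: mult_left_mono mult.assoc)
  qed
  moreover obtain i0 where "i0 < n" "cmod (u i0) = U"
  proof -
    have "U \<in> (\<lambda>i. cmod (u i)) ` {..<n}"
      unfolding U_def using n by (intro Max_in) (auto simp: lessThan_empty_iff)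
    then show ?thesis using that by auto
  qed
  ultimately have "U \<le> cmod \<beta> * real K * real n ^ 3 + U / 2" by metis
  then show ?thesis using U[OF i] by simp
qed

text \<open>Averaging the expansion over the rows turns its terms into \<open>mean_power\<close>:
  the term 0 is 1, the others form a geometric series, and the remainder is bounded crudely. The
  gain \<open>1 / cmod z\<close> is retained because the mean will be multiplied by a number
  \<open>c\<close> of order \<open>sqrt n\<close>, and must still be accurate to o(1) where
  \<open>z\<close> has that size.\<close>

lemma resolvent_mean_bound:
  assumes n: "0 < n" and r: "1 < r" "r \<le> cmod z"
    and pw: "\<And>k i j. k \<le> K \<Longrightarrow> i < n \<Longrightarrow> j < n \<Longrightarrow> cmod (mat_power n a k i j) \<le> real n ^ 2"
    and mp: "\<And>k. 1 \<le> k \<Longrightarrow> k \<le> K \<Longrightarrow> cmod (mean_power n a k) \<le> \<delta>"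
    and K: "0 < K" "real n ^ 7 * real K \<le> r ^ (K - 1)" "2 * real n ^ 3 \<le> r ^ K"
    and u: "\<And>i. i < n \<Longrightarrow> (\<Sum>j<n. ((if i = j then z else 0) - a i j) * u j) = z"
  shows "cmod ((\<Sum>i<n. u i) / of_nat n - 1) \<le> (\<delta> * (r / (r - 1)) + 2 / real n) / cmod z"
proof -
  have z1: "1 \<le> cmod z" using r by simp
  then have z0: "z \<noteq> 0" by auto
  have \<delta>0: "0 \<le> \<delta>" using mp[of 1] K(1) norm_ge_zero[of "mean_power n a 1"] by linarith
  have "2 * real n ^ 3 \<le> cmod z ^ K" using K(3) r by (meson order_trans power_mono zero_le_one less_imp_le)
  then have ub: "cmod (u i) \<le> 2 * real K * real n ^ 3" if "i < n" for i
    using resolvent_bound[where \<beta> = 1 and u = u, OF n pw z1] u that by simp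
  let ?R = "\<lambda>i. \<Sum>j<n. mat_power n a K i j * u j"
  have "(\<Sum>i<n. u i) = (\<Sum>i<n. (\<Sum>m<K. (\<Sum>j<n. mat_power n a m i j) / z ^ m) + ?R i / z ^ K)"
    using resolvent_expansion[OF z0, of n a u 1 _ K] u by (intro sum.cong) auto
  also have "\<dots> = (\<Sum>m<K. of_nat n * mean_power n a m / z ^ m) + (\<Sum>i<n. ?R i) / z ^ K"
    unfolding sum.distrib
    by (subst sum.swap) (use n in \<open>simp add: mean_power_def flip: sum_divide_distrib\<close>)
  also have "\<dots> = of_nat n * (\<Sum>m<K. mean_power n a m / z ^ m) + (\<Sum>i<n. ?R i) / z ^ K"
    by (simp add: sum_distrib_left)
  also have "(\<Sum>m<K. mean_power n a m / z ^ m) = 1 + (\<Sum>m\<in>{1..<K}. mean_power n a m / z ^ m)"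
  proof -
    have "mean_power n a 0 = 1" using n by (simp add: mean_power_def)
    then show ?thesis
      unfolding lessThan_atLeast0 using K(1) by (subst sum.atLeast_Suc_lessThan) auto
  qed
  finally have eq: "(\<Sum>i<n. u i) / of_nat n - 1
      = (\<Sum>m\<in>{1..<K}. mean_power n a m / z ^ m) + (\<Sum>i<n. ?R i) / of_nat n / z ^ K"
    using n by (simp add: field_simps)
  have sum1: "cmod (\<Sum>m\<in>{1..<K}. mean_power n a m / z ^ m) \<le> \<delta> * (r / (r - 1)) / cmod z"
  proof -
    have "cmod (\<Sum>m\<in>{1..<K}. mean_power n a m / z ^ m) \<le> (\<Sum>m\<in>{1..<K}. \<delta> / cmod z * (1 / r) ^ (m - 1))"
    proof (rule sum_norm_le)
      fix m assume m: "m \<in> {1..<K}"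
      have "cmod (mean_power n a m / z ^ m) = cmod (mean_power n a m) / (cmod z * cmod z ^ (m - 1))"
        using m by (cases m) (auto simp: norm_divide norm_power norm_mult)
      also have "\<dots> \<le> \<delta> / (cmod z * r ^ (m - 1))"
        using m r z0 mp \<delta>0 by (intro frac_le mult_left_mono power_mono) auto
      finally show "cmod (mean_power n a m / z ^ m) \<le> \<delta> / cmod z * (1 / r) ^ (m - 1)"
        by (simp add: power_one_over field_simps)
    qed
    also have "\<dots> = \<delta> / cmod z * (\<Sum>m\<in>{1..<K}. (1 / r) ^ (m - 1))" by (simp add: sum_distrib_left)
    also have "(\<Sum>m\<in>{1..<K}. (1 / r) ^ (m - 1)) = (\<Sum>m<K - 1. (1 / r) ^ m)"
      by (rule sum.reindex_bij_witness[where i = Suc and j = "\<lambda>m. m - 1"]) auto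
    also have "\<dots> \<le> (\<Sum>m. (1 / r) ^ m)"
      using r by (intro sum_le_suminf summable_geometric) auto
    also have "\<dots> = r / (r - 1)" using r by (subst suminf_geometric) (auto simp: field_simps)
    finally show ?thesis using \<delta>0
      by (simp add: mult_left_mono divide_right_mono mult.commute[of "cmod z"])
  qed
  \<comment> \<open>Entries at most \<open>n ^ 2\<close>, rows of length \<open>n\<close> and the
    bound \<open>2 * K * n ^ 3\<close> for \<open>u\<close> give \<open>2 * n ^ 6 * K\<close>. One
    factor of \<open>z\<close> is set aside; the other \<open>K - 1\<close> beat
    \<open>n ^ 7 * K\<close> and leave \<open>2 / n\<close>.\<close>
  have sum2: "cmod ((\<Sum>i<n. ?R i) / of_nat n / z ^ K) \<le> 2 / real n / cmod z"
  proof -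
    have "cmod (?R i) \<le> (\<Sum>j<n. real n ^ 2 * (2 * real K * real n ^ 3))" if "i < n" for i
      using that pw ub by (intro sum_norm_le) (auto simp: norm_mult intro!: mult_mono)
    then have "cmod (\<Sum>i<n. ?R i) \<le> (\<Sum>i<n. \<Sum>j<n. real n ^ 2 * (2 * real K * real n ^ 3))"
      by (rule sum_norm_le) simp
    also have "\<dots> = real n * (2 * (real n ^ 6 * real K))" by (simp add: eval_nat_numeral algebra_simps)
    finally have "cmod ((\<Sum>i<n. ?R i) / of_nat n) \<le> 2 * (real n ^ 6 * real K)"
      using n by (simp add: norm_divide field_simps)
    then have "cmod ((\<Sum>i<n. ?R i) / of_nat n / z ^ K) \<le> 2 * (real n ^ 6 * real K) / cmod z ^ K"
      by (subst norm_divide[of _ "z ^ K"], subst norm_power) (intro divide_right_mono, auto)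
    also have "\<dots> = 2 * (real n ^ 7 * real K) / real n / (cmod z * cmod z ^ (K - 1))"
      using n K(1) by (cases K) (auto simp: eval_nat_numeral)
    also have "\<dots> \<le> 2 * r ^ (K - 1) / real n / (cmod z * r ^ (K - 1))"
      using n K r z0 by (intro frac_le divide_right_mono mult_left_mono power_mono mult_nonneg_nonneg mult_pos_pos) auto
    also have "\<dots> = 2 / real n / cmod z" using r by simp
    finally show ?thesis .
  qed
  show ?thesis unfolding eq
    by (rule order_trans[OF norm_triangle_ineq]) (use sum1 sum2 in \<open>simp add: add_divide_distrib\<close>)
qed


text \<open>Adding \<open>c / n\<close> to every entry is adding \<open>c\<close> times the
  projection onto \<phi>, and \<open>f\<close> is the quadratic form of \<open>z\<close> times the
  resolvent at \<phi>. The factor \<open>z\<close> on the left makes the second factor on the right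
  a perturbation of \<open>z - c\<close>.\<close>

lemma char_poly_rank_one_perturbation:
  fixes a :: "nat \<Rightarrow> nat \<Rightarrow> complex"
  assumes n: "0 < n" and r: "1 < r" "r \<le> cmod z"
    and pw: "\<And>k i j. k \<le> K \<Longrightarrow> i < n \<Longrightarrow> j < n \<Longrightarrow> cmod (mat_power n a k i j) \<le> real n ^ 2"
    and mp: "\<And>k. 1 \<le> k \<Longrightarrow> k \<le> K \<Longrightarrow> cmod (mean_power n a k) \<le> \<delta>"
    and K: "0 < K" "real n ^ 7 * real K \<le> r ^ (K - 1)" "2 * real n ^ 3 \<le> r ^ K"
  shows "poly (char_poly (mat n n (\<lambda>(i, j). a i j))) z \<noteq> 0"
    and "\<exists>f. cmod (f - 1) \<le> (\<delta> * (r / (r - 1)) + 2 / real n) / cmod z \<and>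
      z * poly (char_poly (mat n n (\<lambda>(i, j). a i j + c / of_nat n))) z
        = poly (char_poly (mat n n (\<lambda>(i, j). a i j))) z * (z - c * f)"
proof -
  let ?b = "\<lambda>i j. (if i = j then z else 0) - a i j"
  have z1: "1 \<le> cmod z" using r by simp
  then have z0: "z \<noteq> 0" by auto
  have zK: "2 * real n ^ 3 \<le> cmod z ^ K"
    using K(3) power_mono[OF r(2), of K] r(1) by simp
  have nz: "det (mat n n (\<lambda>(i, j). ?b i j)) \<noteq> 0"
  proof
    assume "det (mat n n (\<lambda>(i, j). ?b i j)) = 0"
    from det_zero_kernel[OF this] obtain v where
      v: "\<exists>i<n. v i \<noteq> 0" "\<And>i. i < n \<Longrightarrow> (\<Sum>j<n. ?b i j * v j) = 0" by blast
    have "cmod (v i) \<le> 2 * cmod 0 * real K * real n ^ 3" if "i < n" for i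
      by (rule resolvent_bound[OF n pw z1 zK _ that]) (use v in auto)
    then show False using v(1) by auto
  qed
  then show "poly (char_poly (mat n n (\<lambda>(i, j). a i j))) z \<noteq> 0"
    by (simp add: poly_char_poly_mat)
  obtain u where u: "\<And>i. i < n \<Longrightarrow> (\<Sum>j<n. ?b i j * u j) = z"
    using det_nonzero_solve[OF nz, of "\<lambda>_. z"] by blast
  define f where "f = (\<Sum>i<n. u i) / of_nat n"
  have "cmod (f - 1) \<le> (\<delta> * (r / (r - 1)) + 2 / real n) / cmod z"
    unfolding f_def by (rule resolvent_mean_bound[OF n r pw mp K u])
  moreover have "z * poly (char_poly (mat n n (\<lambda>(i, j). a i j + c / of_nat n))) z
        = poly (char_poly (mat n n (\<lambda>(i, j). a i j))) z * (z - c * f)"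
  proof -
    have "det (mat n n (\<lambda>(i, j). ?b i j - c / of_nat n))
        = det (mat n n (\<lambda>(i, j). ?b i j)) * (1 - c / of_nat n / z * (\<Sum>i<n. u i))"
      by (rule det_minus_const[OF u z0])
    moreover have "(\<lambda>(i, j). ?b i j - c / of_nat n)
        = (\<lambda>(i, j). (if i = j then z else 0) - (a i j + c / of_nat n))" by (auto simp: fun_eq_iff)
    ultimately have "poly (char_poly (mat n n (\<lambda>(i, j). a i j + c / of_nat n))) z
        = poly (char_poly (mat n n (\<lambda>(i, j). a i j))) z * (1 - c / of_nat n / z * (\<Sum>i<n. u i))"
      by (simp only: poly_char_poly_mat)
    moreover have "z * (1 - c / of_nat n / z * (\<Sum>i<n. u i)) = z - c * f"
      using z0 by (simp add: f_def field_simps)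
    ultimately show ?thesis by (metis mult.left_commute)
  qed
  ultimately show "\<exists>f. cmod (f - 1) \<le> (\<delta> * (r / (r - 1)) + 2 / real n) / cmod z \<and>
      z * poly (char_poly (mat n n (\<lambda>(i, j). a i j + c / of_nat n))) z
        = poly (char_poly (mat n n (\<lambda>(i, j). a i j))) z * (z - c * f)" by blast
qed

text \<open>Rouche's theorem compares \<open>z * char_poly M\<close> with
  \<open>(z - c) * char_poly A\<close> on the circle of radius \<open>3 * \<tau>\<close> about
  \<open>c\<close>: there \<open>cmod z \<ge> cmod c / 2\<close>, so the difference is at most
  \<open>2 * \<tau>\<close> times the common factor. Any eigenvalue outside the disk of radius
  \<open>r\<close> satisfies \<open>cmod (z - c) \<le> cmod c * \<tau> / cmod z\<close>; it lies in
  the ball if \<open>cmod z \<ge> cmod c / 2\<close>, and otherwise would be within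
  \<open>cmod c / 3\<close> of \<open>c\<close>, which is absurd.\<close>

lemma single_outlier:
  fixes a :: "nat \<Rightarrow> nat \<Rightarrow> complex" and c :: complex and n :: nat and r \<delta> :: real
  defines "M \<equiv> mat n n (\<lambda>(i, j). a i j + c / of_nat n)"
  defines "\<tau> \<equiv> \<delta> * (r / (r - 1)) + 2 / real n"
  assumes n: "0 < n" and r: "1 < r"
    and pw: "\<And>k i j. k \<le> K \<Longrightarrow> i < n \<Longrightarrow> j < n \<Longrightarrow> cmod (mat_power n a k i j) \<le> real n ^ 2"
    and mp: "\<And>k. 1 \<le> k \<Longrightarrow> k \<le> K \<Longrightarrow> cmod (mean_power n a k) \<le> \<delta>"
    and K: "0 < K" "real n ^ 7 * real K \<le> r ^ (K - 1)" "2 * real n ^ 3 \<le> r ^ K"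
    and c: "2 * r + 2 \<le> cmod c" and \<tau>: "3 * \<tau> \<le> 1"
  shows "\<exists>l. cmod (l - c) \<le> 3 * \<tau> \<and> order l (char_poly M) = 1
    \<and> (\<forall>z. eigenvalue M z \<and> z \<noteq> l \<longrightarrow> cmod z \<le> r)"
proof -
  define A where "A = mat n n (\<lambda>(i, j). a i j)"
  define p where "p = [:0, 1:] * char_poly M"
  define p0 where "p0 = [:- c, 1:] * char_poly A"
  have \<delta>0: "0 \<le> \<delta>" using mp[of 1] K(1) norm_ge_zero[of "mean_power n a 1"] by linarith
  have "0 \<le> \<delta> * (r / (r - 1))" using \<delta>0 r by (intro mult_nonneg_nonneg) auto
  then have \<tau>0: "0 < \<tau>" using n by (simp add: \<tau>_def add_nonneg_pos)
  have Anz: "poly (char_poly A) z \<noteq> 0" if "r \<le> cmod z" for z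
    unfolding A_def by (rule char_poly_rank_one_perturbation(1)[OF n r that pw mp K])
  have pert: "\<exists>f. cmod (f - 1) \<le> \<tau> / cmod z \<and> poly p z = poly (char_poly A) z * (z - c * f)"
    if "r \<le> cmod z" for z
    using char_poly_rank_one_perturbation(2)[OF n r that pw mp K, of c]
    by (simp add: p_def A_def M_def \<tau>_def)
  \<comment> \<open>The assumption \<open>2 * r + 2 \<le> cmod c\<close> places the unit ball about
    \<open>c\<close> outside the disk of radius \<open>r\<close> and beyond half the modulus of
    \<open>c\<close>.\<close>
  have big: "r \<le> cmod z" "cmod c / 2 \<le> cmod z" if "cmod (z - c) \<le> 1" for z
  proof -
    have "cmod c - cmod z \<le> 1" using that norm_triangle_ineq2[of c z] by (simp add: norm_minus_commute)
    then show "r \<le> cmod z" "cmod c / 2 \<le> cmod z" using c r by linarith+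
  qed
  have c0: "0 < cmod c" using c r by linarith
  have key: "cmod c * (\<tau> / cmod z) \<le> 2 * \<tau>" if "cmod c / 2 \<le> cmod z" for z
  proof -
    have "0 < cmod z" using that c0 by linarith
    then have "cmod c * (\<tau> / cmod z) \<le> cmod c * (\<tau> / (cmod c / 2))"
      using that \<tau>0 c0 by (intro mult_left_mono divide_left_mono mult_pos_pos) auto
    also have "\<dots> = 2 * \<tau>" using c0 by simp
    finally show ?thesis .
  qed
  have "(\<Sum>z | poly p z = 0 \<and> z \<in> ball c (3 * \<tau>). order z p)
      = (\<Sum>z | poly p0 z = 0 \<and> z \<in> ball c (3 * \<tau>). order z p0)"
  proof (rule rouche_poly)
    fix z assume z: "dist c z = 3 * \<tau>"
    then have zc: "cmod (z - c) = 3 * \<tau>" by (simp add: dist_norm norm_minus_commute)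
    have zb: "r \<le> cmod z" "cmod c / 2 \<le> cmod z" using big[of z] zc \<tau> by auto
    obtain f where f: "cmod (f - 1) \<le> \<tau> / cmod z" "poly p z = poly (char_poly A) z * (z - c * f)"
      using pert[OF zb(1)] by blast
    have "poly p z - poly p0 z = poly (char_poly A) z * (- (c * (f - 1)))"
      unfolding f(2) by (simp add: p0_def algebra_simps)
    then have "cmod (poly p z - poly p0 z) = cmod (poly (char_poly A) z) * (cmod c * cmod (f - 1))"
      by (simp add: norm_mult)
    also have "\<dots> < cmod (poly (char_poly A) z) * (3 * \<tau>)"
    proof (rule mult_strict_left_mono)
      have "cmod c * cmod (f - 1) \<le> cmod c * (\<tau> / cmod z)" by (intro mult_left_mono f) auto
      then show "cmod c * cmod (f - 1) < 3 * \<tau>" using key[OF zb(2)] \<tau>0 by linarith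
    qed (use Anz[OF zb(1)] in auto)
    also have "\<dots> = cmod (poly p0 z)"
    proof -
      have "poly p0 z = poly (char_poly A) z * (z - c)" by (simp add: p0_def algebra_simps)
      then show ?thesis using zc by (simp only: norm_mult)
    qed
    finally show "cmod (poly p z - poly p0 z) < cmod (poly p0 z)" .
  qed (use \<tau>0 in simp)
  also have "{z. poly p0 z = 0 \<and> z \<in> ball c (3 * \<tau>)} = {c}"
  proof -
    have "z = c" if "poly p0 z = 0" "z \<in> ball c (3 * \<tau>)" for z
    proof -
      have "cmod (z - c) \<le> 1" using that(2) \<tau> by (simp add: dist_norm norm_minus_commute)
      then show ?thesis using that(1) Anz[OF big(1)] by (auto simp: p0_def)
    qed
    then show ?thesis using \<tau>0 by (auto simp: p0_def)
  qed
  also have "(\<Sum>z\<in>{c}. order z p0) = 1"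
  proof -
    have cA: "poly (char_poly A) c \<noteq> 0" using Anz[OF big(1)[of c]] by simp
    then have "order c (char_poly A) = 0" "char_poly A \<noteq> 0" by (auto simp: order_root)
    moreover have "order c [:- c, 1:] = 1" using order_power_n_n[of c 1] by simp
    moreover have "order c p0 = order c [:- c, 1:] + order c (char_poly A)"
      unfolding p0_def using \<open>char_poly A \<noteq> 0\<close>
      by (intro order_mult) (simp only: mult_eq_0_iff pCons_eq_0_iff one_neq_zero, simp)
    ultimately show ?thesis by simp
  qed
  finally have sum1: "(\<Sum>z | poly p z = 0 \<and> z \<in> ball c (3 * \<tau>). order z p) = 1" .
  have M: "M \<in> carrier_mat n n" by (simp add: M_def)
  have M0: "char_poly M \<noteq> 0" using degree_monic_char_poly[OF M] by auto
  then have p0': "p \<noteq> 0" by (simp add: p_def)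
  obtain l where l: "l \<in> ball c (3 * \<tau>)" "order l p = 1"
      "\<And>z. z \<in> ball c (3 * \<tau>) \<Longrightarrow> poly p z = 0 \<Longrightarrow> z = l"
    using sum_order_eq_1_unique[OF p0' sum1] by blast
  have lc: "cmod (l - c) < 3 * \<tau>" using l(1) by (simp add: dist_norm norm_minus_commute)
  \<comment> \<open>The auxiliary factor \<open>z\<close> of \<open>p\<close> vanishes only at 0, so
    the order of \<open>l\<close> is that in \<open>char_poly M\<close>.\<close>
  have "l \<noteq> 0" using big(1)[of l] lc \<tau> r by auto
  then have "order l [:0, 1:] = 0" by (simp add: order_0I)
  then have "order l (char_poly M) = 1"
    using l(2) p0' order_mult[of "[:0, 1:]" "char_poly M" l] unfolding p_def by linarith
  moreover have "cmod z \<le> r" if z: "eigenvalue M z" "z \<noteq> l" for z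
  proof (rule ccontr)
    assume "\<not> cmod z \<le> r"
    then have rz: "r \<le> cmod z" by simp
    have pz: "poly p z = 0" using z(1) eigenvalue_root_char_poly[OF M] by (simp add: p_def)
    obtain f where f: "cmod (f - 1) \<le> \<tau> / cmod z" "poly p z = poly (char_poly A) z * (z - c * f)"
      using pert[OF rz] by blast
    then have "z - c = c * (f - 1)" using pz Anz[OF rz] by (simp add: algebra_simps)
    then have d: "cmod (z - c) \<le> cmod c * (\<tau> / cmod z)"
      using f(1) by (simp only: norm_mult) (intro mult_left_mono, auto)
    show False
    proof (cases "cmod c / 2 \<le> cmod z")
      case True
      then have "cmod (z - c) < 3 * \<tau>" using d key[OF True] \<tau>0 by linarith
      then show False using l(3)[of z] pz z(2) by (simp add: dist_norm norm_minus_commute)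
    next
      case False
      have "\<tau> / cmod z \<le> \<tau> / 1" using rz r \<tau>0 by (intro divide_left_mono) auto
      then have "\<tau> / cmod z \<le> 1 / 3" using \<tau> by linarith
      then have "cmod c * (\<tau> / cmod z) \<le> cmod c * (1 / 3)" by (rule mult_left_mono) simp
      moreover have "cmod c - cmod z \<le> cmod (z - c)"
        using norm_triangle_ineq2[of c z] by (simp add: norm_minus_commute)
      ultimately show False using d False c0 by linarith
    qed
  qed
  ultimately show ?thesis using lc by (intro exI[of _ l]) auto
qed

section \<open>Fourth moments of sums over walks\<close>

definition walk_prod :: "(nat \<Rightarrow> nat \<Rightarrow> complex) \<Rightarrow> nat \<Rightarrow> (nat \<Rightarrow> nat) \<Rightarrow> complex" where
  "walk_prod a k v = (\<Prod>t<k. a (v t) (v (Suc t)))"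

lemma mat_power_eq_walk_sum:
  assumes "i < n" "j < n"
  shows "mat_power n a k i j = (\<Sum>v | v \<in> PiE {..k} (\<lambda>_. {..<n}) \<and> v 0 = i \<and> v k = j. walk_prod a k v)"
  using assms(2)
proof (induction k arbitrary: j)
  case 0
  show ?case
  proof (cases "i = j")
    case True
    have "{v. v \<in> PiE {..0::nat} (\<lambda>_. {..<n}) \<and> v 0 = i \<and> v 0 = j} = {\<lambda>t\<in>{..0}. i}"
      using True assms(1) by (auto simp: PiE_def extensional_def restrict_def fun_eq_iff)
    then show ?thesis using True by (simp add: walk_prod_def)
  next
    case False
    then have "{v. v \<in> PiE {..0::nat} (\<lambda>_. {..<n}) \<and> v 0 = i \<and> v 0 = j} = {}" by auto
    then show ?thesis using False by (simp only: mat_power.simps if_False sum.empty)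
  qed
next
  case (Suc k)
  let ?P = "PiE {..k} (\<lambda>_. {..<n})"
  let ?W = "{v. v \<in> ?P \<and> v 0 = i}"
  have finW: "finite ?W" by (rule finite_subset[of _ ?P]) (auto intro: finite_PiE)
  have "mat_power n a (Suc k) i j
      = (\<Sum>l<n. \<Sum>v | v \<in> ?P \<and> v 0 = i \<and> v k = l. walk_prod a k v * a (v k) j)"
    by (simp add: Suc.IH sum_distrib_right)
  also have "\<dots> = (\<Sum>l<n. \<Sum>v\<in>{v\<in>?W. v k = l}. walk_prod a k v * a (v k) j)"
    by (intro sum.cong) auto
  also have "\<dots> = (\<Sum>v\<in>?W. walk_prod a k v * a (v k) j)"
    using finW by (intro sum.group) auto
  also have "\<dots> = (\<Sum>v | v \<in> PiE {..Suc k} (\<lambda>_. {..<n}) \<and> v 0 = i \<and> v (Suc k) = j. walk_prod a (Suc k) v)"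
  proof (rule sum.reindex_bij_witness[where i = "\<lambda>v. restrict v {..k}" and j = "\<lambda>v. v(Suc k := j)"])
    fix v assume v: "v \<in> ?W"
    show "restrict (v(Suc k := j)) {..k} = v"
      using v by (auto simp: PiE_def extensional_def restrict_def fun_eq_iff)
    show "v(Suc k := j) \<in> {v. v \<in> PiE {..Suc k} (\<lambda>_. {..<n}) \<and> v 0 = i \<and> v (Suc k) = j}"
      using v Suc.prems by (auto simp: PiE_def extensional_def Pi_def)
    show "walk_prod a (Suc k) (v(Suc k := j)) = walk_prod a k v * a (v k) j"
      by (simp add: walk_prod_def)
  next
    fix v assume v: "v \<in> {v. v \<in> PiE {..Suc k} (\<lambda>_. {..<n}) \<and> v 0 = i \<and> v (Suc k) = j}"
    show "(restrict v {..k})(Suc k := j) = v"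
      using v by (auto simp: PiE_def extensional_def restrict_def fun_eq_iff le_Suc_eq)
    show "restrict v {..k} \<in> ?W"
      using v by (auto simp: PiE_def extensional_def restrict_def Pi_def)
  qed
  finally show ?case .
qed

lemma mean_power_eq_walk_sum:
  "mean_power n a k = (\<Sum>v\<in>PiE {..k} (\<lambda>_. {..<n}). walk_prod a k v) / of_nat n"
proof -
  let ?P = "PiE {..k} (\<lambda>_. {..<n})"
  have fin: "finite ?P" by (auto intro: finite_PiE)
  have "(\<Sum>i<n. \<Sum>j<n. mat_power n a k i j)
      = (\<Sum>i<n. \<Sum>j<n. \<Sum>v\<in>{v\<in>{v\<in>?P. v 0 = i}. v k = j}. walk_prod a k v)"
    by (intro sum.cong refl) (auto simp: mat_power_eq_walk_sum intro!: sum.cong)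
  also have "\<dots> = (\<Sum>i<n. \<Sum>v\<in>{v\<in>?P. v 0 = i}. walk_prod a k v)"
    using fin by (intro sum.cong refl sum.group) auto
  also have "\<dots> = (\<Sum>v\<in>?P. walk_prod a k v)"
    using fin by (intro sum.group) auto
  finally show ?thesis by (simp add: mean_power_def)
qed

definition concat_walks :: "nat \<Rightarrow> (nat \<Rightarrow> nat \<Rightarrow> nat) \<Rightarrow> nat \<Rightarrow> nat" where
  "concat_walks k vs = (\<lambda>t\<in>{..<4 * Suc k}. vs (t div Suc k) (t mod Suc k))"

lemma concat_walks_nth:
  assumes "b < 4" "i \<le> k"
  shows "concat_walks k vs (b * Suc k + i) = vs b i"
proof -
  have "b * Suc k \<le> 3 * Suc k" using assms by (intro mult_right_mono) auto
  then have "b * Suc k + i < 4 * Suc k" using assms by simp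
  moreover have "(b * Suc k + i) div Suc k = b" "(b * Suc k + i) mod Suc k = i"
    using assms by (auto simp: div_add1_eq[of _ _ "Suc k"] simp del: mult_Suc_right)
  ultimately show ?thesis by (simp add: concat_walks_def)
qed

lemma concat_walks_in_PiE:
  assumes "vs \<in> PiE {..<4} (\<lambda>_. PiE {..k} (\<lambda>_. A))"
  shows "concat_walks k vs \<in> PiE {..<4 * Suc k} (\<lambda>_. A)"
proof -
  have "vs (t div Suc k) (t mod Suc k) \<in> A" if "t < 4 * Suc k" for t
  proof -
    have "t div Suc k < 4" using that by (simp only: less_mult_imp_div_less)
    then have "vs (t div Suc k) \<in> PiE {..k} (\<lambda>_. A)" using assms by (auto simp: PiE_def)
    moreover have "t mod Suc k \<le> k" using mod_less_divisor[of "Suc k" t] by linarith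
    ultimately show ?thesis by (auto simp: PiE_def)
  qed
  then show ?thesis unfolding concat_walks_def by (intro restrict_PiE_iff[THEN iffD2]) auto
qed

lemma inj_on_concat_walks: "inj_on (concat_walks k) (PiE {..<4} (\<lambda>_. PiE {..k} (\<lambda>_. A)))"
proof (rule inj_onI)
  fix vs vs' assume vs: "vs \<in> PiE {..<4} (\<lambda>_. PiE {..k} (\<lambda>_. A))" "vs' \<in> PiE {..<4} (\<lambda>_. PiE {..k} (\<lambda>_. A))"
    and eq: "concat_walks k vs = concat_walks k vs'"
  have "vs b i = vs' b i" if "b < 4" "i \<le> k" for b i
    using concat_walks_nth[OF that, of vs] concat_walks_nth[OF that, of vs'] eq by simp
  moreover have "vs b \<in> PiE {..k} (\<lambda>_. A)" "vs' b \<in> PiE {..k} (\<lambda>_. A)" if "b < 4" for b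
    using vs that by (auto simp: PiE_def)
  ultimately have "vs b = vs' b" if "b \<in> {..<4}" for b
    using that by (intro PiE_ext[of "vs b" "{..k}" "\<lambda>_. A"]) auto
  then show "vs = vs'" using vs by (intro PiE_ext[of vs "{..<4}" "\<lambda>_. PiE {..k} (\<lambda>_. A)"]) auto
qed

text \<open>The maps \<open>h b\<close> will be the identity or complex conjugation; their
  multiplicativity lets a conjugation of a whole walk product be applied step by step.\<close>

lemma prod_walk_prod_eq:
  assumes h: "\<And>b. h b 1 = 1" "\<And>b x y. h b (x * y) = h b x * h b y"
  shows "(\<Prod>b<4. h b (walk_prod a k (vs b)))
    = (\<Prod>t\<in>steps k. h (t div Suc k) (case edge (concat_walks k vs) t of (i, j) \<Rightarrow> a i j))"
proof -
  have hp: "h b (\<Prod>i\<in>I. f i) = (\<Prod>i\<in>I. h b (f i))" for b f and I :: "nat set"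
    by (induction I rule: infinite_finite_induct) (auto simp: h)
  have "(\<Prod>b<4. h b (walk_prod a k (vs b))) = (\<Prod>(b, i)\<in>{..<4} \<times> {..<k}. h b (a (vs b i) (vs b (Suc i))))"
    by (simp add: walk_prod_def hp prod.cartesian_product)
  also have "\<dots> = (\<Prod>t\<in>steps k. h (t div Suc k) (case edge (concat_walks k vs) t of (i, j) \<Rightarrow> a i j))"
    unfolding steps_image
  proof (subst prod.reindex[OF inj_steps], intro prod.cong refl, clarify)
    fix b i :: nat assume bi: "b < 4" "i < k"
    have "concat_walks k vs (b * Suc k + Suc i) = vs b (Suc i)"
      using bi by (intro concat_walks_nth) auto
    moreover have "concat_walks k vs (b * Suc k + i) = vs b i"
      using bi by (intro concat_walks_nth) auto
    moreover have "(b * Suc k + Suc i) div Suc k = b"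
      using bi by (auto simp: div_add1_eq[of _ _ "Suc k"] simp del: mult_Suc_right add_Suc_right)
    ultimately show "h b (a (vs b i) (vs b (Suc i)))
        = ((\<lambda>t. h (t div Suc k) (case edge (concat_walks k vs) t of (i, j) \<Rightarrow> a i j))
             \<circ> (\<lambda>(b, i). b * Suc k + Suc i)) (b, i)"
      by (simp add: edge_def del: mult_Suc_right)
  qed
  finally show ?thesis .
qed

text \<open>The entries after truncation, centring and division by \<open>sqrt n\<close>. Truncation
  can lower the variance, hence an inequality; \<eta> does not shrink with \<open>n\<close>.\<close>

locale bounded_iid_entries = prob_space M for M :: "'w measure" +
  fixes a :: "nat \<Rightarrow> nat \<Rightarrow> 'w \<Rightarrow> complex" and n :: nat and \<eta> :: real
  assumes indep: "indep_vars (\<lambda>_. borel) (\<lambda>(i, j). a i j) UNIV"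
    and bounded: "\<And>i j \<omega>. cmod (a i j \<omega>) \<le> \<eta>"
    and mean_zero: "\<And>i j. expectation (a i j) = 0"
    and variance_le: "\<And>i j. expectation (\<lambda>\<omega>. (cmod (a i j \<omega>))\<^sup>2) \<le> 1 / real n"
begin

lemma eta_nonneg: "0 \<le> \<eta>"
  using bounded[of 0 0 undefined] norm_ge_zero order_trans by blast

lemma entry_measurable [measurable]: "a i j \<in> borel_measurable M"
proof -
  have "\<forall>p\<in>UNIV. (case p of (i, j) \<Rightarrow> a i j) \<in> borel_measurable M"
    using indep unfolding indep_vars_def2 by (rule conjunct1)
  from bspec[OF this, of "(i, j)"] show ?thesis by simp
qed

lemma integrable_bounded:
  fixes f :: "'w \<Rightarrow> 'b :: {banach, second_countable_topology}"
  assumes "f \<in> borel_measurable M" "\<And>\<omega>. norm (f \<omega>) \<le> B"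
  shows "integrable M f"
  by (rule integrable_const_bound[of _ B]) (use assms in auto)

lemma moment_le:
  assumes "2 \<le> m"
  shows "expectation (\<lambda>\<omega>. cmod (a i j \<omega>) ^ m) \<le> \<eta> ^ (m - 2) * (1 / real n)"
proof -
  have "expectation (\<lambda>\<omega>. cmod (a i j \<omega>) ^ m) \<le> expectation (\<lambda>\<omega>. \<eta> ^ (m - 2) * (cmod (a i j \<omega>))\<^sup>2)"
  proof (rule integral_mono)
    show "integrable M (\<lambda>\<omega>. cmod (a i j \<omega>) ^ m)"
      by (rule integrable_bounded[of _ "\<eta> ^ m"]) (auto intro!: power_mono bounded)
    have "integrable M (\<lambda>\<omega>. (cmod (a i j \<omega>))\<^sup>2)"
      by (rule integrable_bounded[of _ "\<eta>\<^sup>2"]) (auto intro!: power_mono bounded)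
    then show "integrable M (\<lambda>\<omega>. \<eta> ^ (m - 2) * (cmod (a i j \<omega>))\<^sup>2)" by simp
    fix \<omega>
    have "cmod (a i j \<omega>) ^ m = cmod (a i j \<omega>) ^ (m - 2) * (cmod (a i j \<omega>))\<^sup>2"
      by (metis assms le_add_diff_inverse2 power_add)
    then show "cmod (a i j \<omega>) ^ m \<le> \<eta> ^ (m - 2) * (cmod (a i j \<omega>))\<^sup>2"
      by (auto intro!: mult_right_mono power_mono bounded)
  qed
  also have "\<dots> = \<eta> ^ (m - 2) * expectation (\<lambda>\<omega>. (cmod (a i j \<omega>))\<^sup>2)" by simp
  also have "\<dots> \<le> \<eta> ^ (m - 2) * (1 / real n)"
    by (intro mult_left_mono variance_le) (simp add: eta_nonneg)
  finally show ?thesis .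
qed

text \<open>Grouping the steps by edges makes the expectation a product over distinct edges, by
  independence. Conjugation affects neither the modulus nor the vanishing of the mean.\<close>

lemma norm_expectation_walk_le:
  assumes h: "\<And>t. h t = id \<or> h t = cnj"
  shows "cmod (expectation (\<lambda>\<omega>. \<Prod>t\<in>steps k. h t (case edge w t of (i, j) \<Rightarrow> a i j \<omega>)))
    \<le> walk_weight n k \<eta> w"
proof -
  define E where "E = edge w ` steps k"
  define X where "X = (\<lambda>(i, j). a i j)"
  define T where "T e = {t\<in>steps k. edge w t = e}" for e
  define G where "G e z = (\<Prod>t\<in>T e. h t z)" for e z
  have fin: "finite E" "finite (T e)" for e by (auto simp: E_def T_def)
  have hm [measurable]: "h t \<in> borel_measurable borel" for t
  proof -
    have "continuous_on UNIV (h t)" using h[of t] by (auto intro!: continuous_intros simp: id_def)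
    then show ?thesis by (rule borel_measurable_continuous_onI)
  qed
  have hn: "cmod (h t z) = cmod z" for t z using h[of t] by auto
  have Gm [measurable]: "G e \<in> borel_measurable borel" for e unfolding G_def by measurable
  have Xm [measurable]: "X e \<in> borel_measurable M" for e by (cases e) (auto simp: X_def)
  have Gn: "cmod (G e z) = cmod z ^ card (T e)" for e z
    by (simp add: G_def hn flip: prod_norm)
  have Gi: "integrable M (\<lambda>\<omega>. G e (X e \<omega>))" for e
    by (rule integrable_bounded[of _ "\<eta> ^ card (T e)"])
       (auto simp: Gn X_def case_prod_beta intro!: power_mono bounded)
  have "expectation (\<lambda>\<omega>. \<Prod>t\<in>steps k. h t (case edge w t of (i, j) \<Rightarrow> a i j \<omega>))
      = expectation (\<lambda>\<omega>. \<Prod>e\<in>E. G e (X e \<omega>))"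
  proof (rule Bochner_Integration.integral_cong[OF refl])
    fix \<omega>
    have "(\<Prod>e\<in>E. G e (X e \<omega>)) = (\<Prod>e\<in>E. \<Prod>t\<in>{t\<in>steps k. edge w t = e}. h t (case edge w t of (i, j) \<Rightarrow> a i j \<omega>))"
      unfolding G_def T_def by (intro prod.cong refl) (auto simp: X_def case_prod_beta)
    also have "\<dots> = (\<Prod>t\<in>steps k. h t (case edge w t of (i, j) \<Rightarrow> a i j \<omega>))"
      unfolding E_def by (intro prod.group) auto
    finally show "(\<Prod>t\<in>steps k. h t (case edge w t of (i, j) \<Rightarrow> a i j \<omega>)) = (\<Prod>e\<in>E. G e (X e \<omega>))" ..
  qed
  also have "\<dots> = (\<Prod>e\<in>E. expectation (\<lambda>\<omega>. G e (X e \<omega>)))"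
  proof (rule indep_vars_lebesgue_integral[OF fin(1) _ Gi])
    have "indep_vars (\<lambda>_. borel) X E"
      using indep unfolding X_def by (rule indep_vars_subset) auto
    then show "indep_vars (\<lambda>_. borel) (\<lambda>e \<omega>. G e (X e \<omega>)) E"
      by (rule indep_vars_compose2) measurable
  qed
  finally have eq: "cmod (expectation (\<lambda>\<omega>. \<Prod>t\<in>steps k. h t (case edge w t of (i, j) \<Rightarrow> a i j \<omega>)))
      = (\<Prod>e\<in>E. cmod (expectation (\<lambda>\<omega>. G e (X e \<omega>))))"
    by (simp only: prod_norm)
  show ?thesis
  proof (cases "edges_covered_twice k w")
    case True
    then have two: "2 \<le> card (T e)" if "e \<in> E" for e
      using that by (auto simp: edges_covered_twice_def T_def E_def)
    have "cmod (expectation (\<lambda>\<omega>. G e (X e \<omega>))) \<le> \<eta> ^ (card (T e) - 2) * (1 / real n)" if "e \<in> E" for e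
    proof -
      obtain i j where e: "e = (i, j)" by (cases e)
      have "cmod (expectation (\<lambda>\<omega>. G e (X e \<omega>))) \<le> expectation (\<lambda>\<omega>. cmod (G e (X e \<omega>)))"
        by (rule integral_norm_bound)
      also have "\<dots> = expectation (\<lambda>\<omega>. cmod (a i j \<omega>) ^ card (T e))" by (simp add: Gn X_def e)
      also have "\<dots> \<le> \<eta> ^ (card (T e) - 2) * (1 / real n)" by (rule moment_le) (rule two[OF that])
      finally show ?thesis .
    qed
    then have "(\<Prod>e\<in>E. cmod (expectation (\<lambda>\<omega>. G e (X e \<omega>)))) \<le> (\<Prod>e\<in>E. \<eta> ^ (card (T e) - 2) * (1 / real n))"
      by (intro prod_mono) auto
    also have "\<dots> = \<eta> ^ (\<Sum>e\<in>E. card (T e) - 2) * (1 / real n) ^ card E"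
      by (simp only: prod.distrib power_sum prod_constant)
    also have "(\<Sum>e\<in>E. card (T e) - 2) = 4 * k - 2 * card E"
    proof -
      have "(\<Sum>e\<in>E. card (T e)) = 4 * k"
        unfolding E_def T_def card_steps[symmetric] by (rule sum_card_fibres) simp
      moreover have "(\<Sum>e\<in>E. card (T e) - 2) + (\<Sum>e\<in>E. 2) = (\<Sum>e\<in>E. card (T e))"
        unfolding sum.distrib[symmetric] using two by (intro sum.cong refl le_add_diff_inverse2) auto
      ultimately show ?thesis by simp
    qed
    finally show ?thesis unfolding eq using True by (simp add: walk_weight_def E_def mult.commute)
  next
    case False
    then obtain e where e: "e \<in> E" "card (T e) < 2"
      by (metis edges_covered_twice_def E_def T_def not_le)
    then have "card (T e) \<noteq> 0" by (auto simp: E_def T_def)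
    then have "card (T e) = 1" using e by simp
    then obtain t where t: "T e = {t}" by (auto simp: card_1_singleton_iff)
    obtain i j where ij: "e = (i, j)" by (cases e)
    have "expectation (\<lambda>\<omega>. G e (X e \<omega>)) = expectation (\<lambda>\<omega>. h t (a i j \<omega>))"
    proof -
      have "G e z = h t z" for z by (simp add: G_def t)
      then show ?thesis by (simp only: X_def) (simp add: ij)
    qed
    also have "\<dots> = 0" using h[of t] mean_zero[of i j] by auto
    finally have "(\<Prod>e\<in>E. cmod (expectation (\<lambda>\<omega>. G e (X e \<omega>)))) = 0"
      using e fin by (intro prod_zero) auto
    then show ?thesis unfolding eq using eta_nonneg by (simp add: walk_weight_nonneg)
  qed
qed

text \<open>The fourth power expands into quadruples of walks from \<open>W\<close>. Their bounds
  \<open>walk_weight\<close> are nonnegative, so the sum may be enlarged to all quadruples; one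
  estimate then serves both walks with fixed ends and all walks.\<close>

lemma fourth_moment_walk_sum_le:
  assumes W: "W \<subseteq> PiE {..k} (\<lambda>_. {..<n})"
  shows "integrable M (\<lambda>\<omega>. cmod (\<Sum>v\<in>W. walk_prod (\<lambda>i j. a i j \<omega>) k v) ^ 4)"
    and "expectation (\<lambda>\<omega>. cmod (\<Sum>v\<in>W. walk_prod (\<lambda>i j. a i j \<omega>) k v) ^ 4)
      \<le> (\<Sum>w\<in>PiE {..<4 * Suc k} (\<lambda>_. {..<n}). walk_weight n k \<eta> w)"
proof -
  \<comment> \<open>Two walks are taken plain and two conjugated, as in the fourth power of the
    modulus.\<close>
  define h where "h b = (if b < (2::nat) then id else cnj)" for b
  define Q where "Q \<omega> = (\<Sum>v\<in>W. walk_prod (\<lambda>i j. a i j \<omega>) k v)" for \<omega>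
  let ?V = "PiE {..<4::nat} (\<lambda>_. W)"
  let ?F = "\<lambda>vs \<omega>. \<Prod>t\<in>steps k. h (t div Suc k) (case edge (concat_walks k vs) t of (i, j) \<Rightarrow> a i j \<omega>)"
  have h: "h b = id \<or> h b = cnj" for b by (auto simp: h_def)
  have hn: "cmod (h b z) = cmod z" for b z using h[of b] by auto
  have finW: "finite W" using W by (rule finite_subset) (auto intro: finite_PiE)
  have expand: "complex_of_real (cmod (Q \<omega>) ^ 4) = (\<Sum>vs\<in>?V. ?F vs \<omega>)" for \<omega>
  proof -
    have "complex_of_real (cmod (Q \<omega>) ^ 4) = (Q \<omega> * cnj (Q \<omega>)) * (Q \<omega> * cnj (Q \<omega>))"
      unfolding complex_norm_square[symmetric] by (simp add: power2_eq_square numeral_eq_Suc)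
    also have "\<dots> = (\<Prod>b<4. h b (Q \<omega>))"
      by (simp add: h_def numeral_eq_Suc)
    also have "\<dots> = (\<Prod>b<4. \<Sum>v\<in>W. h b (walk_prod (\<lambda>i j. a i j \<omega>) k v))"
      unfolding Q_def h_def by (intro prod.cong) auto
    also have "\<dots> = (\<Sum>vs\<in>?V. \<Prod>b<4. h b (walk_prod (\<lambda>i j. a i j \<omega>) k (vs b)))"
      using finW by (intro prod_sum_PiE) auto
    also have "\<dots> = (\<Sum>vs\<in>?V. ?F vs \<omega>)"
      by (intro sum.cong refl prod_walk_prod_eq) (auto simp: h_def)
    finally show ?thesis .
  qed
  have Fm: "?F vs \<in> borel_measurable M" for vs
  proof -
    have hm [measurable]: "h b \<in> borel_measurable borel" for b
    proof -
      have "continuous_on UNIV (h b)" using h[of b] by (auto intro!: continuous_intros simp: id_def)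
      then show ?thesis by (rule borel_measurable_continuous_onI)
    qed
    show ?thesis unfolding case_prod_beta by measurable
  qed
  have Fi: "integrable M (?F vs)" for vs
  proof (rule integrable_bounded[OF Fm])
    show "cmod (?F vs \<omega>) \<le> (\<Prod>t\<in>steps k. \<eta>)" for \<omega>
      unfolding prod_norm[symmetric]
      by (intro prod_mono) (auto simp: hn case_prod_beta bounded)
  qed
  have "integrable M (\<lambda>\<omega>. complex_of_real (cmod (Q \<omega>) ^ 4))"
    unfolding expand by (intro Bochner_Integration.integrable_sum Fi)
  then show "integrable M (\<lambda>\<omega>. cmod (\<Sum>v\<in>W. walk_prod (\<lambda>i j. a i j \<omega>) k v) ^ 4)"
    by (simp only: complex_of_real_integrable_eq Q_def)
  have "complex_of_real (expectation (\<lambda>\<omega>. cmod (Q \<omega>) ^ 4)) = (\<Sum>vs\<in>?V. expectation (?F vs))"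
    unfolding integral_complex_of_real[symmetric] expand
    by (intro Bochner_Integration.integral_sum Fi)
  then have "cmod (complex_of_real (expectation (\<lambda>\<omega>. cmod (Q \<omega>) ^ 4))) \<le> (\<Sum>vs\<in>?V. cmod (expectation (?F vs)))"
    by (simp only: norm_sum)
  then have "expectation (\<lambda>\<omega>. cmod (Q \<omega>) ^ 4) \<le> (\<Sum>vs\<in>?V. cmod (expectation (?F vs)))"
    by (simp only: norm_of_real)
  also have "\<dots> \<le> (\<Sum>vs\<in>?V. walk_weight n k \<eta> (concat_walks k vs))"
    by (intro sum_mono norm_expectation_walk_le h)
  also have "\<dots> = (\<Sum>w\<in>concat_walks k ` ?V. walk_weight n k \<eta> w)"
  proof -
    have "inj_on (concat_walks k) ?V"
      by (rule inj_on_subset[OF inj_on_concat_walks[of k "{..<n}"]]) (intro PiE_mono W)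
    then show ?thesis by (simp add: sum.reindex)
  qed
  also have "\<dots> \<le> (\<Sum>w\<in>PiE {..<4 * Suc k} (\<lambda>_. {..<n}). walk_weight n k \<eta> w)"
  proof (rule sum_mono2)
    have "?V \<subseteq> PiE {..<4} (\<lambda>_. PiE {..k} (\<lambda>_. {..<n}))" by (intro PiE_mono W)
    then show "concat_walks k ` ?V \<subseteq> PiE {..<4 * Suc k} (\<lambda>_. {..<n})"
      by (intro image_subsetI concat_walks_in_PiE) (erule subsetD)
  qed (auto intro: finite_PiE walk_weight_nonneg eta_nonneg)
  finally show "expectation (\<lambda>\<omega>. cmod (\<Sum>v\<in>W. walk_prod (\<lambda>i j. a i j \<omega>) k v) ^ 4)
      \<le> (\<Sum>w\<in>PiE {..<4 * Suc k} (\<lambda>_. {..<n}). walk_weight n k \<eta> w)"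
    unfolding Q_def .
qed

lemma prob_walk_sum_ge_le:
  assumes W: "W \<subseteq> PiE {..k} (\<lambda>_. {..<n})" and c: "0 < c"
    and S: "(\<Sum>w\<in>PiE {..<4 * Suc k} (\<lambda>_. {..<n}). walk_weight n k \<eta> w) \<le> S"
  shows "{\<omega>\<in>space M. c < cmod (\<Sum>v\<in>W. walk_prod (\<lambda>i j. a i j \<omega>) k v)} \<in> events"
    and "prob {\<omega>\<in>space M. c < cmod (\<Sum>v\<in>W. walk_prod (\<lambda>i j. a i j \<omega>) k v)} \<le> S / c ^ 4"
proof -
  let ?Q = "\<lambda>\<omega>. cmod (\<Sum>v\<in>W. walk_prod (\<lambda>i j. a i j \<omega>) k v)"
  have Qm [measurable]: "?Q \<in> borel_measurable M" unfolding walk_prod_def by measurable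
  show "{\<omega>\<in>space M. c < ?Q \<omega>} \<in> events" by measurable
  have "prob {\<omega>\<in>space M. c < ?Q \<omega>} \<le> prob {\<omega>\<in>space M. c ^ 4 \<le> ?Q \<omega> ^ 4}"
    using c by (intro finite_measure_mono) (auto intro!: power_mono)
  also have "\<dots> \<le> expectation (\<lambda>\<omega>. ?Q \<omega> ^ 4) / c ^ 4"
    using c by (intro integral_Markov_inequality_measure[of _ _ "{}"] fourth_moment_walk_sum_le W) auto
  also have "\<dots> \<le> S / c ^ 4"
    using c fourth_moment_walk_sum_le(2)[OF W] S by (intro divide_right_mono) auto
  finally show "prob {\<omega>\<in>space M. c < ?Q \<omega>} \<le> S / c ^ 4" .
qed

text \<open>For each \<open>k\<close>, Markov's inequality for fourth powers and a union bound over
  \<open>n ^ 2\<close> entries at threshold \<open>n ^ 2\<close> give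
  \<open>n ^ 2 * S / n ^ 8\<close>; the mean exceeds \<delta> when the sum over all walks exceeds
  \<open>n * \<delta>\<close>. The case \<open>k = 0\<close> is deterministic.\<close>

lemma prob_large_powers_le:
  assumes n: "0 < n" and \<delta>: "0 < \<delta>"
    and S: "\<And>k. 1 \<le> k \<Longrightarrow> k \<le> K \<Longrightarrow> (\<Sum>w\<in>PiE {..<4 * Suc k} (\<lambda>_. {..<n}). walk_weight n k \<eta> w) \<le> S"
  shows "\<exists>B\<in>events. prob B \<le> real K * (S / real n ^ 6 + S / (real n * \<delta>) ^ 4) \<and>
    (\<forall>\<omega>\<in>space M - B.
      (\<forall>k\<le>K. \<forall>i<n. \<forall>j<n. cmod (mat_power n (\<lambda>i j. a i j \<omega>) k i j) \<le> real n ^ 2) \<and>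
      (\<forall>k. 1 \<le> k \<longrightarrow> k \<le> K \<longrightarrow> cmod (mean_power n (\<lambda>i j. a i j \<omega>) k) \<le> \<delta>))"
proof -
  define W where "W k i j = {v. v \<in> PiE {..k} (\<lambda>_. {..<n}) \<and> v 0 = i \<and> v k = j}" for k :: nat and i j
  define Q where "Q k V \<omega> = cmod (\<Sum>v\<in>V. walk_prod (\<lambda>i j. a i j \<omega>) k v)" for k V \<omega>
  define B1 where "B1 k p = {\<omega>\<in>space M. real n ^ 2 < Q k (W k (fst p) (snd p)) \<omega>}" for k p
  define B2 where "B2 k = {\<omega>\<in>space M. real n * \<delta> < Q k (PiE {..k} (\<lambda>_. {..<n})) \<omega>}" for k
  define B where "B k = (\<Union>p\<in>{..<n} \<times> {..<n}. B1 k p) \<union> B2 k" for k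
  have B1: "B1 k p \<in> events" "prob (B1 k p) \<le> S / (real n ^ 2) ^ 4" if "1 \<le> k" "k \<le> K" for k p
    unfolding B1_def Q_def using n by (intro prob_walk_sum_ge_le S that; auto simp: W_def)+
  have B2: "B2 k \<in> events" "prob (B2 k) \<le> S / (real n * \<delta>) ^ 4" if "1 \<le> k" "k \<le> K" for k
    unfolding B2_def Q_def using n \<delta> by (intro prob_walk_sum_ge_le S that; auto)+
  have B: "B k \<in> events" "prob (B k) \<le> S / real n ^ 6 + S / (real n * \<delta>) ^ 4" if k: "1 \<le> k" "k \<le> K" for k
  proof -
    show "B k \<in> events" unfolding B_def using B1(1)[OF k] B2(1)[OF k] by auto
    have "prob (\<Union>p\<in>{..<n} \<times> {..<n}. B1 k p) \<le> (\<Sum>p\<in>{..<n} \<times> {..<n}. prob (B1 k p))"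
      using B1(1)[OF k] by (intro finite_measure_subadditive_finite) auto
    also have "\<dots> \<le> (\<Sum>p\<in>{..<n} \<times> {..<n}. S / (real n ^ 2) ^ 4)"
      by (intro sum_mono B1(2) k)
    also have "\<dots> = S / real n ^ 6"
      using n by (simp add: field_simps eval_nat_numeral)
    finally have "prob (\<Union>p\<in>{..<n} \<times> {..<n}. B1 k p) \<le> S / real n ^ 6" .
    moreover have "prob (B k) \<le> prob (\<Union>p\<in>{..<n} \<times> {..<n}. B1 k p) + prob (B2 k)"
      unfolding B_def using B1(1)[OF k] B2(1)[OF k] by (intro measure_Un_le) auto
    ultimately show "prob (B k) \<le> S / real n ^ 6 + S / (real n * \<delta>) ^ 4" using B2(2)[OF k] by linarith
  qed
  have Bm: "(\<Union>k\<in>{1..K}. B k) \<in> events" using B by auto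
  have "prob (\<Union>k\<in>{1..K}. B k) \<le> (\<Sum>k\<in>{1..K}. prob (B k))"
    using B(1) by (intro finite_measure_subadditive_finite) auto
  also have "\<dots> \<le> (\<Sum>k\<in>{1..K}. S / real n ^ 6 + S / (real n * \<delta>) ^ 4)" using B(2) by (intro sum_mono) auto
  also have "\<dots> = real K * (S / real n ^ 6 + S / (real n * \<delta>) ^ 4)" by simp
  finally have "prob (\<Union>k\<in>{1..K}. B k) \<le> real K * (S / real n ^ 6 + S / (real n * \<delta>) ^ 4)" .
  moreover have "cmod (mat_power n (\<lambda>i j. a i j \<omega>) k i j) \<le> real n ^ 2"
    if "\<omega> \<in> space M - (\<Union>k\<in>{1..K}. B k)" "k \<le> K" "i < n" "j < n" for \<omega> k i j
  proof (cases "k = 0")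
    case True
    then show ?thesis using n by (auto simp: Suc_leI)
  next
    case False
    then have "\<omega> \<notin> B1 k (i, j)" using that by (auto simp: B_def)
    then show ?thesis using that by (auto simp: B1_def Q_def W_def mat_power_eq_walk_sum)
  qed
  moreover have "cmod (mean_power n (\<lambda>i j. a i j \<omega>) k) \<le> \<delta>"
    if "\<omega> \<in> space M - (\<Union>k\<in>{1..K}. B k)" "1 \<le> k" "k \<le> K" for \<omega> k
  proof -
    have "\<omega> \<notin> B2 k" using that by (auto simp: B_def)
    then have "Q k (PiE {..k} (\<lambda>_. {..<n})) \<omega> \<le> real n * \<delta>" using that by (auto simp: B2_def)
    then show ?thesis using n by (simp add: Q_def mean_power_eq_walk_sum norm_divide field_simps)
  qed
  ultimately show ?thesis using Bm by (intro bexI[of _ "\<Union>k\<in>{1..K}. B k"]) blast+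
qed

end

section \<open>Truncation and almost sure convergence\<close>

text \<open>At \<open>n\<close> the tolerance \<open>1 / Suc m\<close> is used with the largest
  \<open>m\<close> whose threshold \<open>N m\<close> has been passed; the cap
  \<open>m \<le> n\<close> makes this maximum exist.\<close>

lemma diagonal_tolerance:
  fixes P :: "real \<Rightarrow> nat \<Rightarrow> bool"
  assumes "\<And>m. eventually (P (1 / real (Suc m))) sequentially"
  shows "\<exists>c. c \<longlonglongrightarrow> 0 \<and> (\<forall>\<^sub>F n in sequentially. P (c n) n)"
proof -
  have "\<forall>m. \<exists>N. \<forall>n\<ge>N. P (1 / real (Suc m)) n"
    using assms unfolding eventually_sequentially by blast
  then obtain N where N: "\<And>m n. N m \<le> n \<Longrightarrow> P (1 / real (Suc m)) n" by metis
  define g where "g n = Max {m. m \<le> n \<and> N m \<le> n}" for n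
  have fin: "finite {m. m \<le> n \<and> N m \<le> n}" for n by (rule finite_subset[of _ "{..n}"]) auto
  have gN: "N (g n) \<le> n" if "N 0 \<le> n" for n
  proof -
    have "g n \<in> {m. m \<le> n \<and> N m \<le> n}"
      unfolding g_def using that by (intro Max_in fin) auto
    then show ?thesis by simp
  qed
  have "filterlim g at_top sequentially"
    unfolding filterlim_at_top
  proof
    fix m
    have "m \<le> g n" if "max m (N m) \<le> n" for n
      unfolding g_def using that by (intro Max_ge fin) auto
    then show "\<forall>\<^sub>F n in sequentially. m \<le> g n" unfolding eventually_sequentially by blast
  qed
  then have "((\<lambda>m. 1 / real (Suc m)) \<circ> g) \<longlonglongrightarrow> 0"
    unfolding comp_def by (rule filterlim_compose[rotated]) real_asymp
  moreover have "\<forall>\<^sub>F n in sequentially. P (1 / real (Suc (g n))) n"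
    using gN N unfolding eventually_sequentially by blast
  ultimately show ?thesis by (intro exI[of _ "(\<lambda>m. 1 / real (Suc m)) \<circ> g"]) simp
qed

text \<open>A union bound over all \<open>n ^ 2\<close> entries for every \<open>n\<close> would
  need a sixth moment. Instead each entry is compared once, with its own layer
  \<open>max i j = m\<close> of at most \<open>2 * m + 1\<close> entries. The layer probabilities
  are summable: only \<open>m\<close> below \<open>V = (cmod x / \<kappa>)\<^sup>2\<close>
  contribute, and the corresponding odd numbers add up to about \<open>V\<^sup>2\<close>, which has
  finite mean by the fourth moment.\<close>

lemma (in prob_space) entries_eventually_small:
  fixes x :: "nat \<Rightarrow> nat \<Rightarrow> 'a \<Rightarrow> complex"
  assumes rv: "\<And>i j. x i j \<in> borel_measurable M"
    and ident: "\<And>i j. distr M borel (x i j) = distr M borel (x 0 0)"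
    and fourth: "integrable M (\<lambda>\<omega>. (cmod (x 0 0 \<omega>)) ^ 4)"
    and \<kappa>: "0 < \<kappa>"
  shows "AE \<omega> in M. \<forall>\<^sub>F n in sequentially. \<forall>i<n. \<forall>j<n. cmod (x i j \<omega>) \<le> \<kappa> * sqrt (real n)"
proof -
  note rv [measurable]
  define B where "B i j m = {\<omega>\<in>space M. \<kappa> * sqrt (real m) < cmod (x i j \<omega>)}" for i j m
  define pr where "pr m = prob (B 0 0 m)" for m
  define I where "I m = {(i, j). max i j = m}" for m :: nat
  have Bm [measurable]: "B i j m \<in> events" for i j m unfolding B_def by measurable
  have pB: "prob (B i j m) = pr m" for i j m
  proof -
    have "prob (B i j m) = measure (distr M borel (x i j)) {z. \<kappa> * sqrt (real m) < cmod z}" for i j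
      by (subst measure_distr) (auto simp: B_def vimage_def Int_def conj_commute)
    then show ?thesis by (simp add: pr_def ident[of i j])
  qed
  have finI: "finite (I m)" for m unfolding I_def
    by (rule finite_subset[of _ "{..m} \<times> {..m}"]) auto
  have cI: "card (I m) \<le> 2 * m + 1" for m
  proof -
    have "I m \<subseteq> (\<lambda>i. (i, m)) ` {..m} \<union> (\<lambda>j. (m, j)) ` {..<m}"
      unfolding I_def by (auto simp: max_def split: if_splits)
    then have "card (I m) \<le> card ((\<lambda>i. (i, m)) ` {..m} \<union> (\<lambda>j. (m, j)) ` {..<m})"
      by (intro card_mono) auto
    also have "\<dots> \<le> card ((\<lambda>i. (i, m)) ` {..m}) + card ((\<lambda>j. (m, j)) ` {..<m})" by (rule card_Un_le)
    also have "\<dots> \<le> (m + 1) + m" by (intro add_mono order_trans[OF card_image_le]) auto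
    finally show ?thesis by simp
  qed
  define A where "A m = (\<Union>(i, j)\<in>I m. B i j m)" for m
  have Am: "A m \<in> events" for m unfolding A_def using finI by (auto intro!: sets.finite_UN)
  have pA: "prob (A m) \<le> real (2 * m + 1) * pr m" for m
  proof -
    have "prob (A m) \<le> (\<Sum>p\<in>I m. prob (case p of (i, j) \<Rightarrow> B i j m))"
      unfolding A_def using finI by (intro finite_measure_subadditive_finite) auto
    also have "\<dots> = real (card (I m)) * pr m" by (simp add: case_prod_beta pB)
    also have "\<dots> \<le> real (2 * m + 1) * pr m"
      using cI[of m] by (intro mult_right_mono) (auto simp: pr_def simp del: of_nat_add of_nat_mult)
    finally show ?thesis .
  qed
  have "summable (\<lambda>m. real (2 * m + 1) * pr m)"
  proof (rule summableI_nonneg_bounded)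
    show "0 \<le> real (2 * m + 1) * pr m" for m by (simp add: pr_def)
    define V where "V \<omega> = (cmod (x 0 0 \<omega>) / \<kappa>)\<^sup>2" for \<omega>
    have V4: "(V \<omega>)\<^sup>2 = cmod (x 0 0 \<omega>) ^ 4 / \<kappa> ^ 4" for \<omega>
      by (simp add: V_def power_divide flip: power_mult)
    have intV2: "integrable M (\<lambda>\<omega>. (V \<omega>)\<^sup>2)" unfolding V4 using fourth by simp
    have bound: "(\<Sum>m<N. real (2 * m + 1) * indicat_real (B 0 0 m) \<omega>) \<le> 2 * (V \<omega>)\<^sup>2 + 2"
      if "\<omega> \<in> space M" for N \<omega>
    proof -
      have "(\<Sum>m<N. real (2 * m + 1) * indicat_real (B 0 0 m) \<omega>)
          \<le> (\<Sum>m<nat \<lceil>V \<omega>\<rceil>. real (2 * m + 1))"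
      proof -
        have "indicat_real (B 0 0 m) \<omega> = 0" if "\<not> m < nat \<lceil>V \<omega>\<rceil>" for m
        proof -
          have "V \<omega> \<le> real m" using that by linarith
          then have "sqrt (V \<omega>) \<le> sqrt (real m)" by simp
          then have "cmod (x 0 0 \<omega>) / \<kappa> \<le> sqrt (real m)" using \<kappa> by (simp add: V_def)
          then show ?thesis using \<kappa> by (simp add: B_def field_simps)
        qed
        then have "(\<Sum>m<N. real (2 * m + 1) * indicat_real (B 0 0 m) \<omega>)
            = (\<Sum>m\<in>{..<N} \<inter> {..<nat \<lceil>V \<omega>\<rceil>}. real (2 * m + 1) * indicat_real (B 0 0 m) \<omega>)"
          by (intro sum.mono_neutral_right) auto
        also have "\<dots> \<le> (\<Sum>m\<in>{..<N} \<inter> {..<nat \<lceil>V \<omega>\<rceil>}. real (2 * m + 1))"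
          by (intro sum_mono) (auto simp: indicator_def)
        also have "\<dots> \<le> (\<Sum>m<nat \<lceil>V \<omega>\<rceil>. real (2 * m + 1))" by (intro sum_mono2) auto
        finally show ?thesis .
      qed
      also have "\<dots> = (real (nat \<lceil>V \<omega>\<rceil>))\<^sup>2"
      proof -
        have "(\<Sum>m<k. real (2 * m + 1)) = (real k)\<^sup>2" for k
          by (induction k) (auto simp: power2_eq_square algebra_simps)
        then show ?thesis .
      qed
      also have "\<dots> \<le> (V \<omega> + 1)\<^sup>2"
      proof (intro power_mono)
        have "0 \<le> V \<omega>" by (simp add: V_def)
        then show "real (nat \<lceil>V \<omega>\<rceil>) \<le> V \<omega> + 1" by linarith
      qed auto
      also have "\<dots> \<le> 2 * (V \<omega>)\<^sup>2 + 2"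
        using sum_squares_ge_zero[of "V \<omega> - 1" 0] by (simp add: power2_eq_square algebra_simps)
      finally show ?thesis .
    qed
    have Bi: "integrable M (indicat_real (B 0 0 m))" for m
      by (intro integrable_real_indicator Bm) (simp add: emeasure_eq_measure)
    fix N
    have "(\<Sum>m<N. real (2 * m + 1) * pr m) = (\<integral>\<omega>. (\<Sum>m<N. real (2 * m + 1) * indicat_real (B 0 0 m) \<omega>) \<partial>M)"
      by (subst Bochner_Integration.integral_sum) (auto simp: pr_def Bi)
    also have "\<dots> \<le> (\<integral>\<omega>. 2 * (V \<omega>)\<^sup>2 + 2 \<partial>M)"
    proof (rule integral_mono)
      show "integrable M (\<lambda>\<omega>. \<Sum>m<N. real (2 * m + 1) * indicat_real (B 0 0 m) \<omega>)"
        by (intro Bochner_Integration.integrable_sum integrable_mult_right Bi)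
    qed (use intV2 bound in auto)
    finally show "(\<Sum>m<N. real (2 * m + 1) * pr m) \<le> (\<integral>\<omega>. 2 * (V \<omega>)\<^sup>2 + 2 \<partial>M)" .
  qed
  then have "summable (\<lambda>m. prob (A m))"
  proof (rule summable_comparison_test')
    show "norm (prob (A m)) \<le> real (2 * m + 1) * pr m" for m
      using pA[of m] by (simp only: real_norm_def abs_of_nonneg measure_nonneg)
  qed
  then have "AE \<omega> in M. \<forall>\<^sub>F m in sequentially. \<omega> \<in> space M - A m"
    using Am by (intro borel_cantelli_AE1) (auto simp: emeasure_eq_measure)
  then show ?thesis
  proof (rule AE_mp, intro AE_I2 impI)
    fix \<omega> assume \<omega>: "\<omega> \<in> space M" "\<forall>\<^sub>F m in sequentially. \<omega> \<in> space M - A m"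
    then obtain m0 where m0: "\<And>m. m0 \<le> m \<Longrightarrow> \<omega> \<notin> A m"
      unfolding eventually_sequentially by blast
    \<comment> \<open>The finitely many exceptional layers are bounded by the constant
      \<open>D\<close>, which is eventually below \<open>\<kappa> * sqrt n\<close>.\<close>
    define D where "D = (\<Sum>i<m0. \<Sum>j<m0. cmod (x i j \<omega>))"
    have "\<forall>\<^sub>F n in sequentially. D \<le> \<kappa> * sqrt (real n)" using \<kappa> by real_asymp
    then show "\<forall>\<^sub>F n in sequentially. \<forall>i<n. \<forall>j<n. cmod (x i j \<omega>) \<le> \<kappa> * sqrt (real n)"
    proof eventually_elim
      case (elim n)
      show ?case
      proof (intro allI impI)
        fix i j assume ij: "i < n" "j < n"
        show "cmod (x i j \<omega>) \<le> \<kappa> * sqrt (real n)"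
        proof (cases "max i j < m0")
          case True
          have "cmod (x i j \<omega>) \<le> (\<Sum>j<m0. cmod (x i j \<omega>))"
            using True by (intro member_le_sum[of j]) auto
          also have "\<dots> \<le> D"
            unfolding D_def using True by (intro member_le_sum[of i]) (auto intro: sum_nonneg)
          finally show ?thesis using elim by linarith
        next
          case False
          then have "\<omega> \<notin> B i j (max i j)" using m0[of "max i j"] by (auto simp: A_def I_def)
          then have "cmod (x i j \<omega>) \<le> \<kappa> * sqrt (real (max i j))" using \<omega> by (auto simp: B_def not_less)
          also have "\<dots> \<le> \<kappa> * sqrt (real n)" using ij \<kappa> by (intro mult_left_mono) auto
          finally show ?thesis .
        qed
      qed
    qed
  qed
qed


section \<open>Truncated and centred entries\<close>

definition cutoff :: "real \<Rightarrow> complex \<Rightarrow> complex" where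
  "cutoff T z = (if cmod z \<le> T then z else 0)"

lemma cutoff_measurable [measurable]: "cutoff T \<in> borel_measurable borel"
  unfolding cutoff_def by measurable

lemma norm_cutoff_le: "0 \<le> T \<Longrightarrow> cmod (cutoff T z) \<le> T" "cmod (cutoff T z) \<le> cmod z"
  by (auto simp: cutoff_def)

locale iid_entries = prob_space M for M :: "'w measure" +
  fixes x :: "nat \<Rightarrow> nat \<Rightarrow> 'w \<Rightarrow> complex"
  assumes rv [measurable]: "\<And>i j. x i j \<in> borel_measurable M"
    and indep: "indep_vars (\<lambda>_. borel) (\<lambda>(i, j). x i j) UNIV"
    and ident: "\<And>i j. distr M borel (x i j) = distr M borel (x 0 0)"
    and int1: "integrable M (x 0 0)"
    and mean0: "expectation (x 0 0) = 0"
    and int2: "integrable M (\<lambda>\<omega>. (cmod (x 0 0 \<omega>))\<^sup>2)"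
    and var1: "expectation (\<lambda>\<omega>. (cmod (x 0 0 \<omega>))\<^sup>2) = 1"
    and fourth: "integrable M (\<lambda>\<omega>. (cmod (x 0 0 \<omega>)) ^ 4)"
begin

definition trunc_mean :: "real \<Rightarrow> complex" where
  "trunc_mean T = expectation (\<lambda>\<omega>. cutoff T (x 0 0 \<omega>))"

definition trunc_entry :: "real \<Rightarrow> nat \<Rightarrow> nat \<Rightarrow> nat \<Rightarrow> 'w \<Rightarrow> complex" where
  "trunc_entry T n i j \<omega> = (cutoff T (x i j \<omega>) - trunc_mean T) / complex_of_real (sqrt (real n))"

lemma expectation_ident:
  fixes f :: "complex \<Rightarrow> 'b :: {banach, second_countable_topology}"
  assumes [measurable]: "f \<in> borel_measurable borel"
  shows "expectation (\<lambda>\<omega>. f (x i j \<omega>)) = expectation (\<lambda>\<omega>. f (x 0 0 \<omega>))"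
  using integral_distr[of "x i j" M borel f] integral_distr[of "x 0 0" M borel f]
  by (simp add: ident[of i j])

lemma integrable_cutoff: "0 \<le> T \<Longrightarrow> integrable M (\<lambda>\<omega>. cutoff T (x i j \<omega>))"
  by (rule integrable_const_bound[of _ T]) (auto intro: norm_cutoff_le)

lemma norm_trunc_mean_le: "0 \<le> T \<Longrightarrow> cmod (trunc_mean T) \<le> T"
  unfolding trunc_mean_def
  by (rule order_trans[OF integral_norm_bound], rule integral_le_const)
     (auto intro: norm_cutoff_le integrable_norm integrable_cutoff)

text \<open>Since \<open>x\<close> has mean zero, the truncated mean is minus the mean of the tail,
  where \<open>cmod x \<le> cmod x ^ 4 / T ^ 3\<close>. For \<open>T\<close> of order
  \<open>sqrt n\<close> this is small even after multiplication by \<open>sqrt n\<close>.\<close>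

lemma norm_trunc_mean_le_fourth:
  assumes T: "0 < T"
  shows "cmod (trunc_mean T) \<le> expectation (\<lambda>\<omega>. cmod (x 0 0 \<omega>) ^ 4) / T ^ 3"
proof -
  have "trunc_mean T = expectation (\<lambda>\<omega>. cutoff T (x 0 0 \<omega>) - x 0 0 \<omega>)"
    unfolding trunc_mean_def using T
    by (subst Bochner_Integration.integral_diff) (auto intro!: integrable_cutoff int1 simp: mean0)
  also have "cmod \<dots> \<le> expectation (\<lambda>\<omega>. cmod (cutoff T (x 0 0 \<omega>) - x 0 0 \<omega>))"
    by (rule integral_norm_bound)
  also have "\<dots> \<le> expectation (\<lambda>\<omega>. cmod (x 0 0 \<omega>) ^ 4 / T ^ 3)"
  proof (rule integral_mono)
    show "integrable M (\<lambda>\<omega>. cmod (cutoff T (x 0 0 \<omega>) - x 0 0 \<omega>))"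
      using T by (intro integrable_norm Bochner_Integration.integrable_diff integrable_cutoff int1) auto
    show "integrable M (\<lambda>\<omega>. cmod (x 0 0 \<omega>) ^ 4 / T ^ 3)" using fourth by simp
    fix \<omega>
    show "cmod (cutoff T (x 0 0 \<omega>) - x 0 0 \<omega>) \<le> cmod (x 0 0 \<omega>) ^ 4 / T ^ 3"
    proof (cases "cmod (x 0 0 \<omega>) \<le> T")
      case True
      then show ?thesis using T by (simp add: cutoff_def)
    next
      case False
      then have "cmod (x 0 0 \<omega>) * T ^ 3 \<le> cmod (x 0 0 \<omega>) * cmod (x 0 0 \<omega>) ^ 3"
        using T by (intro mult_left_mono power_mono) auto
      then show ?thesis using False T by (simp add: cutoff_def field_simps eval_nat_numeral)
    qed
  qed
  finally show ?thesis by simp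
qed

text \<open>The cutoff is at half of \<open>\<eta> * sqrt n\<close> because subtracting the mean can
  double the bound. Neither truncation nor centring increases the second moment.\<close>

lemma trunc_entry_bounded_iid:
  assumes n: "0 < n" and \<eta>: "0 < \<eta>"
  shows "bounded_iid_entries M (trunc_entry (\<eta> / 2 * sqrt (real n)) n) n \<eta>"
proof unfold_locales
  define T where "T = \<eta> / 2 * sqrt (real n)"
  have T: "0 \<le> T" using \<eta> by (simp add: T_def)
  let ?m = "trunc_mean T"
  show "indep_vars (\<lambda>_. borel) (\<lambda>(i, j). trunc_entry (\<eta> / 2 * sqrt (real n)) n i j) UNIV"
  proof -
    have "indep_vars (\<lambda>_. borel) (\<lambda>p \<omega>. (cutoff T ((case p of (i, j) \<Rightarrow> x i j) \<omega>) - ?m) / complex_of_real (sqrt (real n))) UNIV"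
      using indep by (rule indep_vars_compose2) measurable
    also have "(\<lambda>p \<omega>. (cutoff T ((case p of (i, j) \<Rightarrow> x i j) \<omega>) - ?m) / complex_of_real (sqrt (real n)))
        = (\<lambda>(i, j). trunc_entry (\<eta> / 2 * sqrt (real n)) n i j)"
      by (auto simp: fun_eq_iff trunc_entry_def T_def)
    finally show ?thesis .
  qed
  fix i j
  show "cmod (trunc_entry (\<eta> / 2 * sqrt (real n)) n i j \<omega>) \<le> \<eta>" for \<omega>
  proof -
    have "cmod (cutoff T (x i j \<omega>) - ?m) \<le> T + T"
      using norm_triangle_ineq4[of "cutoff T (x i j \<omega>)" ?m] norm_cutoff_le(1)[OF T, of "x i j \<omega>"]
        norm_trunc_mean_le[OF T] by linarith
    also have "\<dots> = \<eta> * sqrt (real n)" by (simp add: T_def)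
    finally show ?thesis
      unfolding trunc_entry_def T_def[symmetric] using n by (simp add: norm_divide field_simps)
  qed
  have ET: "expectation (\<lambda>\<omega>. cutoff T (x i j \<omega>)) = ?m"
    unfolding trunc_mean_def by (rule expectation_ident) measurable
  show "expectation (trunc_entry (\<eta> / 2 * sqrt (real n)) n i j) = 0"
    unfolding trunc_entry_def T_def[symmetric]
    using ET integrable_cutoff[OF T, of i j] by (simp add: prob_space)
  show "expectation (\<lambda>\<omega>. (cmod (trunc_entry (\<eta> / 2 * sqrt (real n)) n i j \<omega>))\<^sup>2) \<le> 1 / real n"
  proof -
    have iT2: "integrable M (\<lambda>\<omega>. (cmod (cutoff T (x i j \<omega>)))\<^sup>2)"
      by (rule integrable_const_bound[of _ "T\<^sup>2"]) (auto intro!: power_mono norm_cutoff_le T)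
    have iRe: "integrable M (\<lambda>\<omega>. cnj ?m * cutoff T (x i j \<omega>))"
      using integrable_cutoff[OF T, of i j] by simp
    define R where "R \<omega> = Re (cnj ?m * cutoff T (x i j \<omega>))" for \<omega>
    have iR: "integrable M R" unfolding R_def using iRe by (rule integrable_Re)
    have sq: "(cmod (z - m))\<^sup>2 = (cmod z)\<^sup>2 - 2 * Re (cnj m * z) + (cmod m)\<^sup>2" for z m
      unfolding cmod_power2 by (simp add: power2_eq_square algebra_simps)
    have "expectation (\<lambda>\<omega>. (cmod (cutoff T (x i j \<omega>) - ?m))\<^sup>2)
        = expectation (\<lambda>\<omega>. (cmod (cutoff T (x i j \<omega>)))\<^sup>2)
          - 2 * expectation R + (cmod ?m)\<^sup>2"
      unfolding sq R_def[symmetric] using iT2 iR by (simp add: prob_space)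
    also have "expectation R = (cmod ?m)\<^sup>2"
    proof -
      have "expectation R = Re (cnj ?m * ?m)"
        unfolding R_def using integral_Re[OF iRe] ET
        by (simp only: integral_mult_right_zero)
      also have "\<dots> = (cmod ?m)\<^sup>2" unfolding cmod_power2 by (simp add: power2_eq_square)
      finally show ?thesis .
    qed
    also have "expectation (\<lambda>\<omega>. (cmod (cutoff T (x i j \<omega>)))\<^sup>2) - 2 * (cmod ?m)\<^sup>2 + (cmod ?m)\<^sup>2
        \<le> expectation (\<lambda>\<omega>. (cmod (cutoff T (x i j \<omega>)))\<^sup>2)" by simp
    also have "\<dots> = expectation (\<lambda>\<omega>. (cmod (cutoff T (x 0 0 \<omega>)))\<^sup>2)"
      by (rule expectation_ident) measurable
    also have "\<dots> \<le> expectation (\<lambda>\<omega>. (cmod (x 0 0 \<omega>))\<^sup>2)"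
    proof (rule integral_mono[OF _ int2])
      show "integrable M (\<lambda>\<omega>. (cmod (cutoff T (x 0 0 \<omega>)))\<^sup>2)"
        by (rule integrable_const_bound[of _ "T\<^sup>2"]) (auto intro!: power_mono norm_cutoff_le T)
    qed (auto intro!: power_mono norm_cutoff_le)
    finally have "expectation (\<lambda>\<omega>. (cmod (cutoff T (x i j \<omega>) - ?m))\<^sup>2) / real n \<le> 1 / real n"
      unfolding var1 by (intro divide_right_mono) auto
    then show ?thesis
      unfolding trunc_entry_def T_def[symmetric] by (simp add: norm_divide power_divide)
  qed
qed

text \<open>
  Centring the truncated entries changes the matrix by a multiple of the all-ones matrix,
  which is absorbed into \<open>\<mu>\<close>.
\<close>

lemma perturbed_matrix_eq:
  assumes n: "0 < n" and small: "\<And>i j. i < n \<Longrightarrow> j < n \<Longrightarrow> cmod (x i j \<omega>) \<le> T"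
  shows "perturbed_matrix (\<lambda>i j. x i j \<omega>) \<mu> n
    = mat n n (\<lambda>(i, j). trunc_entry T n i j \<omega>
        + ((\<mu> + trunc_mean T) * complex_of_real (sqrt (real n))) / of_nat n)"
  unfolding perturbed_matrix_def
proof (rule cong_mat; clarsimp)
  fix i j assume ij: "i < n" "j < n"
  have "complex_of_real (sqrt (real n)) * complex_of_real (sqrt (real n)) = of_nat n"
    by (simp flip: of_real_mult)
  moreover have "complex_of_real (sqrt (real n)) \<noteq> 0" using n by simp
  ultimately show "x i j \<omega> / complex_of_real (sqrt (real n)) + \<mu> * complex_of_real (sqrt (real n)) / of_nat n
      = trunc_entry T n i j \<omega> + (\<mu> + trunc_mean T) * complex_of_real (sqrt (real n)) / of_nat n"
    using small[OF ij] n by (simp add: trunc_entry_def cutoff_def field_simps)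
qed

text \<open>For a fixed tolerance all parameters can be constants or explicit powers of
  \<open>n\<close>, so the remaining conditions are deterministic asymptotics.\<close>

lemma outlier_eventually:
  fixes \<mu> :: complex
  assumes \<epsilon>: "0 < \<epsilon>" and \<mu>: "\<mu> \<noteq> 0"
  shows "AE \<omega> in M. \<forall>\<^sub>F n in sequentially.
    \<exists>l. cmod (l - \<mu> * complex_of_real (sqrt (real n))) \<le> \<epsilon>
      \<and> eig_mult (perturbed_matrix (\<lambda>i j. x i j \<omega>) \<mu> n) l = 1
      \<and> (\<forall>z. eigenvalue (perturbed_matrix (\<lambda>i j. x i j \<omega>) \<mu> n) z \<and> z \<noteq> l \<longrightarrow> cmod z \<le> 1 + \<epsilon>)"
proof -
  define r where "r = 1 + \<epsilon>"
  \<comment> \<open>Then \<open>r ^ K n \<ge> n ^ 8\<close>: seven powers are demanded by the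
    resolvent estimate, and the eighth pays for \<open>K n\<close> and one factor
    \<open>r\<close>.\<close>
  define C where "C = 8 / ln r"
  define K where "K n = nat \<lceil>C * ln (real n)\<rceil>" for n
  \<comment> \<open>For \<open>k \<le> 2 * C * ln n\<close> this makes
    \<open>exp (8 * \<eta> * k)\<close> at most \<open>n powr (1 / 8)\<close>, which is
    \<open>1 / (q n)\<^sup>2\<close>.\<close>
  define \<eta> where "\<eta> = min 1 (1 / (128 * C))"
  define q where "q n = real n powr (- 1 / 16)" for n
  define T where "T n = \<eta> / 2 * sqrt (real n)" for n
  define S where "S n = 3 * real n powr (19 / 8)" for n
  \<comment> \<open>The summand 1 makes positivity evident. Below, \<open>mb\<close> bounds the
    shift of the outlier caused by centring, and \<open>\<tau>\<close> is the error of
    \<open>single_outlier\<close> for \<open>\<delta> = q n\<close>.\<close>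
  define F where "F = expectation (\<lambda>\<omega>. cmod (x 0 0 \<omega>) ^ 4) + 1"
  define mb where "mb n = F / (\<eta> / 2 * sqrt (real n)) ^ 3 * sqrt (real n)" for n
  define \<tau> where "\<tau> n = q n * (r / (r - 1)) + 2 / real n" for n
  have r: "1 < r" using \<epsilon> by (simp add: r_def)
  have C: "0 < C" using r by (simp add: C_def)
  have \<eta>: "0 < \<eta>" "\<eta> \<le> 1" "\<eta> * (128 * C) \<le> 1"
  proof -
    show "0 < \<eta>" "\<eta> \<le> 1" using C by (auto simp: \<eta>_def)
    have "\<eta> * (128 * C) \<le> 1 / (128 * C) * (128 * C)"
      using C by (intro mult_right_mono) (auto simp: \<eta>_def)
    then show "\<eta> * (128 * C) \<le> 1" using C by simp
  qed
  have F: "0 < F"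
    unfolding F_def by (intro add_nonneg_pos Bochner_Integration.integral_nonneg) auto
  \<comment> \<open>In the last condition the two terms are of order
    \<open>n powr (- 29 / 8)\<close> and \<open>n powr (- 11 / 8)\<close>; the gap to the still
    summable exponent - 5 / 4 absorbs the logarithm.\<close>
  define good where "good n \<longleftrightarrow> 2 \<le> n \<and> 1 \<le> C * ln (real n)
      \<and> 3 * (8 * (C * ln (real n) + 1))\<^sup>2 * q n \<le> 1
      \<and> C * ln (real n) + 1 \<le> real n / r
      \<and> (C * ln (real n) + 1) * (S n / real n ^ 6 + S n / (real n * q n) ^ 4) \<le> real n powr (- 5 / 4)" for n
  have ev_good: "\<forall>\<^sub>F n in sequentially. good n"
  proof -
    have "\<forall>\<^sub>F n in sequentially. 1 \<le> C * ln (real n)" using C by real_asymp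
    moreover have "\<forall>\<^sub>F n in sequentially. 3 * (8 * (C * ln (real n) + 1))\<^sup>2 * q n \<le> 1"
      unfolding q_def using C by real_asymp
    moreover have "\<forall>\<^sub>F n in sequentially. C * ln (real n) + 1 \<le> real n / r"
      using C r by real_asymp
    moreover have "\<forall>\<^sub>F n in sequentially.
        (C * ln (real n) + 1) * (S n / real n ^ 6 + S n / (real n * q n) ^ 4) \<le> real n powr (- 5 / 4)"
      unfolding S_def q_def using C by real_asymp
    ultimately show ?thesis
      using eventually_ge_at_top[of 2] unfolding good_def by eventually_elim blast
  qed
  have Kle: "real (K n) \<le> C * ln (real n) + 1" if "good n" for n
    using that unfolding K_def good_def by linarith
  have Kge: "C * ln (real n) \<le> real (K n)" for n unfolding K_def by linarith
  have q: "0 < q n" "q n \<le> 1" "q n ^ 16 = 1 / real n" "1 / (q n)\<^sup>2 = exp (ln (real n) / 8)"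
      "1 / q n ^ 38 = real n powr (19 / 8)" if "good n" for n
  proof -
    have n: "2 \<le> n" using that by (simp add: good_def)
    show "0 < q n" using n by (simp add: q_def)
    show "q n \<le> 1" using powr_mono[of "- 1 / 16" 0 "real n"] n by (simp add: q_def)
    have pw: "q n ^ m = real n powr (- real m / 16)" for m
      using n by (simp add: q_def powr_power)
    show "q n ^ 16 = 1 / real n" using n by (simp add: pw powr_minus_divide)
    show "1 / (q n)\<^sup>2 = exp (ln (real n) / 8)" using n by (simp add: pw powr_def exp_minus field_simps)
    show "1 / q n ^ 38 = real n powr (19 / 8)" using n by (simp add: pw powr_minus_divide)
  qed
  have walk_bound: "(\<Sum>w\<in>PiE {..<4 * Suc k} (\<lambda>_. {..<n}). walk_weight n k \<eta> w) \<le> S n"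
    if g: "good n" and k: "1 \<le> k" "k \<le> K n" for n k
  proof -
    have kC: "real k \<le> C * ln (real n) + 1" using k Kle[OF g] by linarith
    have L1: "1 \<le> C * ln (real n)" using g by (simp add: good_def)
    have "8 * \<eta> * real k \<le> 8 * \<eta> * (2 * (C * ln (real n)))"
      using kC L1 \<eta> by (intro mult_left_mono) auto
    also have "\<dots> = (\<eta> * (128 * C)) * (ln (real n) / 8)" by simp
    also have "\<dots> \<le> 1 * (ln (real n) / 8)"
      using \<eta> g by (intro mult_right_mono) (auto simp: good_def)
    finally have small: "exp (8 * \<eta> * real k) \<le> 1 / (q n)\<^sup>2" unfolding q(4)[OF g] by simp
    have "(\<Sum>w\<in>PiE {..<4 * Suc k} (\<lambda>_. {..<n}). walk_weight n k \<eta> w)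
        \<le> exp (3 * (real (4 * Suc k))\<^sup>2 * q n) / q n ^ 38"
      using g k by (intro sum_walk_weight_le q \<eta> small) (auto simp: good_def)
    also have "3 * (real (4 * Suc k))\<^sup>2 * q n \<le> 3 * (8 * (C * ln (real n) + 1))\<^sup>2 * q n"
      using k kC q(1)[OF g] by (intro mult_right_mono mult_left_mono power_mono) auto
    also have "\<dots> \<le> 1" using g by (simp add: good_def)
    finally have "(\<Sum>w\<in>PiE {..<4 * Suc k} (\<lambda>_. {..<n}). walk_weight n k \<eta> w) \<le> exp 1 * (1 / q n ^ 38)"
      using q(1)[OF g] by (simp add: divide_right_mono)
    also have "\<dots> \<le> 3 * (1 / q n ^ 38)"
      using q(1)[OF g] exp_le by (intro mult_right_mono) auto
    finally show ?thesis unfolding q(5)[OF g] S_def .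
  qed
  define ok where "ok n \<omega> \<longleftrightarrow> (\<forall>k\<le>K n. \<forall>i<n. \<forall>j<n. cmod (mat_power n (\<lambda>i j. trunc_entry (T n) n i j \<omega>) k i j) \<le> real n ^ 2)
      \<and> (\<forall>k. 1 \<le> k \<longrightarrow> k \<le> K n \<longrightarrow> cmod (mean_power n (\<lambda>i j. trunc_entry (T n) n i j \<omega>) k) \<le> q n)" for n \<omega>
  \<comment> \<open>Where \<open>good n\<close> fails the empty event is taken, so that a whole
    sequence of events can be chosen.\<close>
  have "\<exists>B\<in>events. good n \<longrightarrow> prob B \<le> real n powr (- 5 / 4) \<and> (\<forall>\<omega>\<in>space M - B. ok n \<omega>)" for n
  proof (cases "good n")
    case True
    then have n: "0 < n" by (simp add: good_def)
    have "bounded_iid_entries M (trunc_entry (T n) n) n \<eta>"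
      unfolding T_def by (rule trunc_entry_bounded_iid[OF n \<eta>(1)])
    then have "\<exists>B\<in>events. prob B \<le> real (K n) * (S n / real n ^ 6 + S n / (real n * q n) ^ 4)
        \<and> (\<forall>\<omega>\<in>space M - B. ok n \<omega>)"
      unfolding ok_def by (rule bounded_iid_entries.prob_large_powers_le[OF _ n q(1)[OF True]]) (rule walk_bound[OF True])
    then obtain B where B: "B \<in> events" "prob B \<le> real (K n) * (S n / real n ^ 6 + S n / (real n * q n) ^ 4)"
      "\<forall>\<omega>\<in>space M - B. ok n \<omega>"
      by (elim bexE conjE)
    have "real (K n) * (S n / real n ^ 6 + S n / (real n * q n) ^ 4)
        \<le> (C * ln (real n) + 1) * (S n / real n ^ 6 + S n / (real n * q n) ^ 4)"
      using Kle[OF True] q(1)[OF True] by (intro mult_right_mono) (auto simp: S_def)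
    also have "\<dots> \<le> real n powr (- 5 / 4)" using True by (simp only: good_def)
    finally show ?thesis using B by (intro bexI[of _ B]) auto
  next
    case False
    then show ?thesis by (intro bexI[of _ "{}"]) auto
  qed
  then obtain B where B: "\<And>n. B n \<in> events" "\<And>n. good n \<Longrightarrow> prob (B n) \<le> real n powr (- 5 / 4)"
      "\<And>n \<omega>. good n \<Longrightarrow> \<omega> \<in> space M - B n \<Longrightarrow> ok n \<omega>"
    by metis
  have "summable (\<lambda>n. prob (B n))"
  proof (rule summable_comparison_test_ev)
    show "\<forall>\<^sub>F n in sequentially. norm (prob (B n)) \<le> real n powr (- 5 / 4)"
      using ev_good by eventually_elim (use B(2) in simp)
    show "summable (\<lambda>n. real n powr (- 5 / 4))" by (simp add: summable_real_powr_iff)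
  qed
  then have AE1: "AE \<omega> in M. \<forall>\<^sub>F n in sequentially. \<omega> \<in> space M - B n"
    using B(1) by (intro borel_cantelli_AE1) (auto simp: emeasure_eq_measure)
  have AE2: "AE \<omega> in M. \<forall>\<^sub>F n in sequentially. \<forall>i<n. \<forall>j<n. cmod (x i j \<omega>) \<le> \<eta> / 2 * sqrt (real n)"
    using \<eta> by (intro entries_eventually_small rv ident fourth) auto
  have ev_det: "\<forall>\<^sub>F n in sequentially. 2 * r + 2 \<le> cmod \<mu> * sqrt (real n) - mb n
      \<and> 3 * \<tau> n \<le> 1 \<and> 3 * \<tau> n + mb n \<le> \<epsilon>"
  proof -
    have "0 < cmod \<mu>" using \<mu> by simp
    then have "\<forall>\<^sub>F n in sequentially. 2 * r + 2 \<le> cmod \<mu> * sqrt (real n) - mb n"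
      unfolding mb_def using F \<eta>(1) by real_asymp
    moreover have "\<forall>\<^sub>F n in sequentially. 3 * \<tau> n \<le> 1"
      unfolding \<tau>_def q_def using r by real_asymp
    moreover have "\<forall>\<^sub>F n in sequentially. 3 * \<tau> n + mb n \<le> \<epsilon>"
      unfolding \<tau>_def q_def mb_def using r F \<eta>(1) \<epsilon> by real_asymp
    ultimately show ?thesis by eventually_elim blast
  qed
  show ?thesis
    using AE1 AE2
  proof eventually_elim
    case (elim \<omega>)
    from elim(1) elim(2) ev_good ev_det show ?case
    proof eventually_elim
      case (elim n)
      have g: "good n" by fact
      then have n: "2 \<le> n" by (simp add: good_def)
      let ?m = "trunc_mean (T n)"
      let ?c = "(\<mu> + ?m) * complex_of_real (sqrt (real n))"
      let ?a = "\<lambda>i j. trunc_entry (T n) n i j \<omega>"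
      have ok: "ok n \<omega>" by (rule B(3)[OF g]) (use elim in auto)
      have M: "perturbed_matrix (\<lambda>i j. x i j \<omega>) \<mu> n = mat n n (\<lambda>(i, j). ?a i j + ?c / of_nat n)"
        using n elim(2) by (intro perturbed_matrix_eq) (auto simp: T_def)
      have m: "cmod ?m * sqrt (real n) \<le> mb n"
      proof -
        have "cmod ?m \<le> (F - 1) / T n ^ 3"
          unfolding F_def using norm_trunc_mean_le_fourth[of "T n"] n \<eta>(1) by (simp add: T_def)
        also have "\<dots> \<le> F / T n ^ 3" using \<eta>(1) by (intro divide_right_mono) (auto simp: T_def)
        finally show ?thesis unfolding mb_def T_def by (intro mult_right_mono) auto
      qed
      have cm: "cmod (?c - \<mu> * complex_of_real (sqrt (real n))) \<le> mb n"
        using m by (simp add: algebra_simps norm_mult)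
      have "cmod (\<mu> * complex_of_real (sqrt (real n))) \<le> cmod ?c + mb n"
        using norm_triangle_ineq2[of "\<mu> * complex_of_real (sqrt (real n))" ?c] cm
        by (simp add: norm_minus_commute)
      then have c: "2 * r + 2 \<le> cmod ?c" using elim(4) by (simp add: norm_mult)
      have rK: "real n ^ 8 \<le> r ^ K n"
      proof -
        have "real n ^ 8 = exp (8 * ln (real n))"
          using n by (simp add: exp_of_nat_mult[of 8, simplified])
        also have "8 * ln (real n) = C * ln (real n) * ln r" using r by (simp add: C_def)
        also have "exp \<dots> \<le> exp (real (K n) * ln r)" using Kge[of n] r by (simp add: mult_right_mono)
        also have "\<dots> = r ^ K n" using r by (simp add: exp_of_nat_mult)
        finally show ?thesis .
      qed
      have K0: "0 < K n" using Kge[of n] g unfolding good_def by linarith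
      have K1: "real n ^ 7 * real (K n) \<le> r ^ (K n - 1)"
      proof -
        have "real n ^ 7 * real (K n) \<le> real n ^ 7 * (real n / r)"
          using Kle[OF g] g by (intro mult_left_mono) (auto simp: good_def)
        also have "\<dots> = real n ^ 8 / r" by (simp add: eval_nat_numeral)
        also have "\<dots> \<le> r ^ K n / r" using rK r by (intro divide_right_mono) auto
        also have "\<dots> = r ^ (K n - 1)" using K0 r by (cases "K n") auto
        finally show ?thesis .
      qed
      have K2: "2 * real n ^ 3 \<le> r ^ K n"
      proof -
        have "2 * real n ^ 3 \<le> real n * real n ^ 3" using n by (intro mult_right_mono) auto
        also have "\<dots> = real n ^ 4" by (simp add: eval_nat_numeral)
        also have "\<dots> \<le> real n ^ 8" using n by (intro power_increasing) auto
        finally show ?thesis using rK by linarith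
      qed
      have "\<exists>l. cmod (l - ?c) \<le> 3 * (q n * (r / (r - 1)) + 2 / real n)
          \<and> order l (char_poly (mat n n (\<lambda>(i, j). ?a i j + ?c / of_nat n))) = 1
          \<and> (\<forall>z. eigenvalue (mat n n (\<lambda>(i, j). ?a i j + ?c / of_nat n)) z \<and> z \<noteq> l \<longrightarrow> cmod z \<le> r)"
      proof (rule single_outlier[where K = "K n"])
        show "3 * (q n * (r / (r - 1)) + 2 / real n) \<le> 1" using elim(4) by (simp add: \<tau>_def)
      qed (use n r ok[unfolded ok_def] K0 K1 K2 c in auto)
      then obtain l where l: "cmod (l - ?c) \<le> 3 * \<tau> n"
          "order l (char_poly (perturbed_matrix (\<lambda>i j. x i j \<omega>) \<mu> n)) = 1"
          "\<forall>z. eigenvalue (perturbed_matrix (\<lambda>i j. x i j \<omega>) \<mu> n) z \<and> z \<noteq> l \<longrightarrow> cmod z \<le> r"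
        unfolding M \<tau>_def by blast
      have "cmod (l - \<mu> * complex_of_real (sqrt (real n))) \<le> 3 * \<tau> n + mb n"
        using norm_triangle_ineq[of "l - ?c" "?c - \<mu> * complex_of_real (sqrt (real n))"] l(1) cm by simp
      then have "cmod (l - \<mu> * complex_of_real (sqrt (real n))) \<le> \<epsilon>" using elim(4) by linarith
      then show ?case using l(2,3) unfolding eig_mult_def r_def by blast
    qed
  qed
qed

end

theorem theorem1p9:
  fixes M :: "'w measure" and x :: "nat \<Rightarrow> nat \<Rightarrow> 'w \<Rightarrow> complex" and \<mu> :: complex
  assumes "prob_space M"
    and rv: "\<And>i j. x i j \<in> borel_measurable M"
    and indep: "prob_space.indep_vars M (\<lambda>_. borel) (\<lambda>(i,j). x i j) UNIV"
    and ident: "\<And>i j. distr M borel (x i j) = distr M borel (x 0 0)"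
    and int1: "integrable M (x 0 0)"
    and mean0: "(\<integral>\<omega>. x 0 0 \<omega> \<partial>M) = 0"
    and int2: "integrable M (\<lambda>\<omega>. (cmod (x 0 0 \<omega>))\<^sup>2)"
    and var1: "(\<integral>\<omega>. (cmod (x 0 0 \<omega>))\<^sup>2 \<partial>M) = 1"
    and fourth: "integrable M (\<lambda>\<omega>. (cmod (x 0 0 \<omega>)) ^ 4)"
    and mu: "\<mu> \<noteq> 0"
  shows "AE \<omega> in M. \<exists>c :: nat \<Rightarrow> real. c \<longlonglongrightarrow> 0 \<and>
           (\<forall>\<^sub>F n in sequentially.
              \<exists>l. cmod (l - \<mu> * complex_of_real (sqrt (real n))) \<le> c n
                 \<and> eig_mult (perturbed_matrix (\<lambda>i j. x i j \<omega>) \<mu> n) l = 1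
                 \<and> (\<forall>z. eigenvalue (perturbed_matrix (\<lambda>i j. x i j \<omega>) \<mu> n) z \<and> z \<noteq> l
                        \<longrightarrow> cmod z \<le> 1 + c n))"
proof -
  interpret iid_entries M x
    by (intro iid_entries.intro iid_entries_axioms.intro) (use assms in auto)
  \<comment> \<open>Countably many tolerances share one null set; outside it the sequence
    \<open>c\<close> is built separately for each \<omega>.\<close>
  have "AE \<omega> in M. \<forall>m. \<forall>\<^sub>F n in sequentially.
      \<exists>l. cmod (l - \<mu> * complex_of_real (sqrt (real n))) \<le> 1 / real (Suc m)
        \<and> eig_mult (perturbed_matrix (\<lambda>i j. x i j \<omega>) \<mu> n) l = 1
        \<and> (\<forall>z. eigenvalue (perturbed_matrix (\<lambda>i j. x i j \<omega>) \<mu> n) z \<and> z \<noteq> l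
               \<longrightarrow> cmod z \<le> 1 + 1 / real (Suc m))"
    unfolding AE_all_countable by (intro allI outlier_eventually mu) simp
  then show ?thesis
  proof (rule AE_mp, intro AE_I2 impI)
    fix \<omega> assume "\<forall>m. \<forall>\<^sub>F n in sequentially.
      \<exists>l. cmod (l - \<mu> * complex_of_real (sqrt (real n))) \<le> 1 / real (Suc m)
        \<and> eig_mult (perturbed_matrix (\<lambda>i j. x i j \<omega>) \<mu> n) l = 1
        \<and> (\<forall>z. eigenvalue (perturbed_matrix (\<lambda>i j. x i j \<omega>) \<mu> n) z \<and> z \<noteq> l
               \<longrightarrow> cmod z \<le> 1 + 1 / real (Suc m))"
    then show "\<exists>c :: nat \<Rightarrow> real. c \<longlonglongrightarrow> 0 \<and>
           (\<forall>\<^sub>F n in sequentially.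
              \<exists>l. cmod (l - \<mu> * complex_of_real (sqrt (real n))) \<le> c n
                 \<and> eig_mult (perturbed_matrix (\<lambda>i j. x i j \<omega>) \<mu> n) l = 1
                 \<and> (\<forall>z. eigenvalue (perturbed_matrix (\<lambda>i j. x i j \<omega>) \<mu> n) z \<and> z \<noteq> l
                        \<longrightarrow> cmod z \<le> 1 + c n))"
      by (intro diagonal_tolerance) blast
  qed
qed

end
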